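(* (i) For all integers $m\ge1$, $k\ge1$ and every $\pi\in\mathrm{Evil}(m,k)$: $\psi_p(\pi)=f^{-1}\big(P^{-1}(\Psi_1(P(f(\pi))))\big)$, where $\Psi_1:\mathrm{ParSeq}(m+1,k)\to\mathrm{ParSeq}(m+2,k)$. (ii) For all integers $m\ge1$, $k\ge1$ and every $\pi\in\mathrm{Evil}(m,k)$: $\psi_q(\pi)=f^{-1}\big(P^{-1}(\Psi_2(P(f(\pi))))\big)$, where $\Psi_2:\mathrm{ParSeq}(m+1,k)\to\mathrm{ParSeq}(m+2,k)$. (iii) For all integers $k\ge1$, $n$, $i$ with $k+1\le i\le n-1$ and every $\pi\in\mathrm{Evil}(i-1,k-1)$: $\psi_{i,k,n}(\pi)=f^{-1}\big(P^{-1}(\Phi_{i,k,n}(P(f(\pi))))\big)$.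
   Context: Permutations are in one-line form. A permutation is evil-avoiding if it avoids $2413,4132,4213,3214$; a recoil of $\pi\in S_n$ is $i$ with $\pi^{-1}_i>\pi^{-1}_{i+1}$. $\mathrm{Evil}(m,k)$ is the set of evil-avoiding permutations in $S_m$ with $k$ recoils, and $\mathrm{St}(n,k)$ the set of evil-avoiding $\pi\in S_n$ with $\pi_1=1$ and $k$ recoils. $f(\pi)=[1,\pi_1+1,\dots,\pi_m+1]$ for $\pi\in S_m$; $f$ is a bijection $\mathrm{Evil}(m,k)\to\mathrm{St}(m+1,k)$. Operators: $\rho_{i,j}(\pi)\in S_{n+1}$ (for $\pi\in S_n$) increases every entry $\ge i$ by $1$ and inserts value $i$ at position $j$; $\gamma_{a,b}(\pi)$ ($a>b$) moves the entry at position $a$ to position $b$. $\psi_p=\rho_{1,1}$. For non-identity evil-avoiding $\pi\in S_n$ with smallest recoil $t$: $\pi$ is $(a,b)$-sandwiched ($a\ge0,b\ge1$) if $(\pi_1,\dots,\pi_a)=(1,\dots,a)$ and $(\pi_{n-b+1},\dots,\pi_n)=(a+1,\dots,a+b)$; $\psi_q(\pi)=\gamma_{n-b+2,a+2}(\rho_{t+1,1}(\pi))$ if $\pi$ is $(a,b)$-sandwiched, else $\psi_q(\pi)=\rho_{t+1,1}(\pi)$. For $\pi\in S_{i-1}$, $\psi_{i,k,n}(\pi)=[\pi_1+n-i,\dots,\pi_{i-1}+n-i,1,2,\dots,n-i]\in S_{n-1}$. The Lehmer code of $\sigma\in S_n$ is $(c_1,\dots,c_n)$ with $c_i=|\{j>i:\sigma_j<\sigma_i\}|$.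 A partition is a weakly decreasing tuple of nonnegative integers (trailing zeros may be dropped); its length is the number of nonzero parts. A partition $\lambda$ is valid for $n$ if it is contained in a $\mathrm{length}(\lambda)\times(n-\mathrm{length}(\lambda))$ rectangle and is neither empty nor the whole rectangle. For $1\le k\le n-2$, $\mathrm{ParSeq}(n,k)$ is the set of sequences $(\lambda^1,\dots,\lambda^k)$ of partitions valid for $n$ such that for $1\le i\le k-1$, if $\ell$ is the smallest part of $\lambda^i$ then the first $n-\ell$ parts of $\lambda^{i+1}$ are equal; $\mathrm{ParSeq}(n,0)$ consists of the empty sequence. $P:\mathrm{St}(n,k)\to\mathrm{ParSeq}(n,k)$ is the bijection (due to Kim–Williams) defined as follows: let $c=(c_1,\dots,c_n)$ be the Lehmer code of $\pi^{-1}$, let $a_1<\dots<a_k$ be the positions $i$ with $c_i>c_{i+1}$, $a_0=0$, and set $\lambda^i=(n-a_i,\dots,n-a_i)-(0,\dots,0,c_{a_{i-1}+1},\dots,c_{a_i})$ (both tuples of length $a_i$, the second with $a_{i-1}$ leading zeros, subtraction coordinatewise); $P(\pi)=(\lambda^1,\dots,\lambda^k)$. For $k\ge1$, $\Psi_1:\mathrm{ParSeq}(n-1,k)\to\mathrm{ParSeq}(n,k)$ duplicates the first part of every $\lambda^i$. $\Psi_2:\mathrm{ParSeq}(n-1,k)\to\mathrm{ParSeq}(n,k)$ duplicates the first part of each $\lambda^i$ for $i\ge2$, and replaces $\lambda^1=(\lambda^1_1,\dots,\lambda^1_r)$ by $(\lambda^1_1+1,\lambda^1_1,\dots,\lambda^1_r)$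 if all its parts are equal, and by $(\lambda^1_1+1,\lambda^1_2,\dots,\lambda^1_r)$ otherwise. For $k+1\le i\le n-1$, $\Phi_{i,k,n}:\mathrm{ParSeq}(i,k-1)\to\mathrm{ParSeq}(n,k)$ sends $(\lambda^1,\dots,\lambda^{k-1})$ to $((i-1),\mu^1,\dots,\mu^{k-1})$, where $\mu^j$ is $\lambda^j$ with its first part duplicated $n-i$ times. *)

theory Defs
  imports Main "HOL-Library.Sublist"
begin

definition Sym :: "nat \<Rightarrow> nat list set" where
  "Sym n = {\<pi>. length \<pi> = n \<and> distinct \<pi> \<and> set \<pi> = {1..n}}"

definition contains_pattern :: "nat list \<Rightarrow> nat list \<Rightarrow> bool" where
  "contains_pattern \<pi> \<sigma> \<longleftrightarrow> (\<exists>s. subseq s \<pi> \<and> length s = length \<sigma> \<and>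
     (\<forall>a b. a < length \<sigma> \<longrightarrow> b < length \<sigma> \<longrightarrow> (s ! a < s ! b \<longleftrightarrow> \<sigma> ! a < \<sigma> ! b)))"

definition evil_avoiding :: "nat list \<Rightarrow> bool" where
  "evil_avoiding \<pi> \<longleftrightarrow> (\<forall>\<sigma> \<in> {[2,4,1,3],[4,1,3,2],[4,2,1,3],[3,2,1,4]}. \<not> contains_pattern \<pi> \<sigma>)"

definition perm_inv :: "nat list \<Rightarrow> nat list" where
  "perm_inv \<pi> = map (\<lambda>v. Suc (LEAST j. j < length \<pi> \<and> \<pi> ! j = v)) [1..<Suc (length \<pi>)]"

definition recoils :: "nat list \<Rightarrow> nat set" where
  "recoils \<pi> = {i. 1 \<le> i \<and> i < length \<pi> \<and> perm_inv \<pi> ! (i - 1) > perm_inv \<pi> ! i}"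

definition Evil :: "nat \<Rightarrow> nat \<Rightarrow> nat list set" where
  "Evil m k = {\<pi> \<in> Sym m. evil_avoiding \<pi> \<and> card (recoils \<pi>) = k}"

definition St :: "nat \<Rightarrow> nat \<Rightarrow> nat list set" where
  "St n k = {\<pi> \<in> Evil n k. \<pi> \<noteq> [] \<and> hd \<pi> = 1}"

definition fshift :: "nat list \<Rightarrow> nat list" where
  "fshift \<pi> = 1 # map Suc \<pi>"

definition rho :: "nat \<Rightarrow> nat \<Rightarrow> nat list \<Rightarrow> nat list" where
  "rho i j \<pi> = (let \<pi>' = map (\<lambda>x. if x \<ge> i then x + 1 else x) \<pi>
                in take (j - 1) \<pi>' @ [i] @ drop (j - 1) \<pi>')"

definition gamma :: "nat \<Rightarrow> nat \<Rightarrow> nat list \<Rightarrow> nat list" where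
  "gamma a b \<pi> = (let x = \<pi> ! (a - 1); r = take (a - 1) \<pi> @ drop a \<pi>
                  in take (b - 1) r @ [x] @ drop (b - 1) r)"

definition psi_p :: "nat list \<Rightarrow> nat list" where
  "psi_p = rho 1 1"

definition sandwiched :: "nat \<Rightarrow> nat \<Rightarrow> nat list \<Rightarrow> bool" where
  "sandwiched a b \<pi> \<longleftrightarrow> 1 \<le> b \<and> a + b \<le> length \<pi> \<and>
     take a \<pi> = [1..<Suc a] \<and> drop (length \<pi> - b) \<pi> = [Suc a..<Suc (a + b)]"

definition psi_q :: "nat list \<Rightarrow> nat list" where
  "psi_q \<pi> = (let n = length \<pi>; t = Min (recoils \<pi>) in
     if (\<exists>a b. sandwiched a b \<pi>)
     then (let (a, b) = (SOME ab. sandwiched (fst ab) (snd ab) \<pi>)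
           in gamma (n - b + 2) (a + 2) (rho (t + 1) 1 \<pi>))
     else rho (t + 1) 1 \<pi>)"

definition psi_ikn :: "nat \<Rightarrow> nat \<Rightarrow> nat \<Rightarrow> nat list \<Rightarrow> nat list" where
  "psi_ikn i k n \<pi> = map (\<lambda>x. x + (n - i)) \<pi> @ [1..<Suc (n - i)]"

definition lehmer :: "nat list \<Rightarrow> nat list" where
  "lehmer \<sigma> = map (\<lambda>i. card {j. i < j \<and> j < length \<sigma> \<and> \<sigma> ! j < \<sigma> ! i}) [0..<length \<sigma>]"

definition is_partition :: "nat list \<Rightarrow> bool" where
  "is_partition l \<longleftrightarrow> sorted_wrt (\<ge>) l \<and> (\<forall>x \<in> set l. 0 < x)"

definition drop_trailing_zeros :: "nat list \<Rightarrow> nat list" where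
  "drop_trailing_zeros l = rev (dropWhile (\<lambda>x. x = 0) (rev l))"

definition part :: "nat list \<Rightarrow> nat \<Rightarrow> nat" where
  "part l j = (if j < length l then l ! j else 0)"

definition valid_for :: "nat \<Rightarrow> nat list \<Rightarrow> bool" where
  "valid_for n l \<longleftrightarrow> is_partition l \<and> l \<noteq> [] \<and> length l \<le> n \<and>
     (\<forall>x \<in> set l. x \<le> n - length l) \<and> \<not> (\<forall>x \<in> set l. x = n - length l)"

definition ParSeq :: "nat \<Rightarrow> nat \<Rightarrow> nat list list set" where
  "ParSeq n k = {ls. length ls = k \<and> (k = 0 \<or> (1 \<le> k \<and> k + 2 \<le> n)) \<and>
     (\<forall>l \<in> set ls. valid_for n l) \<and>
     (\<forall>i. i + 1 < k \<longrightarrow>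
        (\<forall>j < n - last (ls ! i). part (ls ! (i + 1)) j = part (ls ! (i + 1)) 0))}"

definition KW_P :: "nat list \<Rightarrow> nat list list" where
  "KW_P \<pi> = (let n = length \<pi>; c = lehmer (perm_inv \<pi>);
              a = filter (\<lambda>i. c ! (i - 1) > c ! i) [1..<n]; a' = 0 # a
     in map (\<lambda>i. drop_trailing_zeros
              (map (\<lambda>j. (n - a' ! (i + 1)) - (if j < a' ! i then 0 else c ! j)) [0..<a' ! (i + 1)]))
            [0..<length a])"

definition Psi1 :: "nat list list \<Rightarrow> nat list list" where
  "Psi1 ls = map (\<lambda>l. hd l # l) ls"

definition Psi2 :: "nat list list \<Rightarrow> nat list list" where
  "Psi2 ls = (case ls of [] \<Rightarrow> []
     | l # rest \<Rightarrow> (if (\<forall>x \<in> set l. x = hd l) then (hd l + 1) # l else (hd l + 1) # tl l)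
                  # map (\<lambda>l. hd l # l) rest)"

definition Phi :: "nat \<Rightarrow> nat \<Rightarrow> nat \<Rightarrow> nat list list \<Rightarrow> nat list list" where
  "Phi i k n ls = [i - 1] # map (\<lambda>l. replicate (n - i) (hd l) @ l) ls"

end

theory Submission
  imports Defs
begin

text \<open>
  Everything is read off the Lehmer code \<open>c\<close> of \<open>\<pi>\<^sup>-\<^sup>1\<close>, whose entry at \<open>v\<close> counts the values larger
  than \<open>v\<close> standing before \<open>v\<close> in \<open>\<pi>\<close>; its descents are the recoils of \<open>\<pi>\<close>, and the shift \<open>f\<close> puts
  a \<open>0\<close> in front of it. As \<open>P\<close> and \<open>f\<close> are injective, each claim amounts to showing that the operator
  on permutations preserves evil avoidance and acts on codes as the operator on partition sequences
  prescribes. On codes, \<open>\<psi>\<^sub>p\<close> prepends a \<open>0\<close> and \<open>\<psi>\<^bsub>i,k,n\<^esub>\<close> prepends \<open>n - i\<close> entries \<open>i - 1\<close>. Writing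
  \<open>c = c\<^sub>1 @ c\<^sub>2\<close> with \<open>c\<^sub>1\<close> the part up to the smallest recoil \<open>t\<close>, the operator \<open>\<psi>\<^sub>q\<close> inserts a \<open>0\<close>
  before \<open>c\<^sub>2\<close> and adds \<open>1\<close> to all entries of \<open>c\<^sub>1\<close>, where in the sandwiched case, which is
  \<open>c\<^sub>1 = (0\<^sup>a, (m - t)\<^sup>b)\<close>, one of the \<open>b\<close> large entries is moreover turned into a \<open>1\<close>. The sandwiched
  case is exactly the one in which all parts of the first partition are equal.
\<close>

section \<open>Evil patterns\<close>

text \<open>The disjuncts are the patterns 2413, 4132, 4213 and 3214, in this order.\<close>

definition evil4 :: "nat \<Rightarrow> nat \<Rightarrow> nat \<Rightarrow> nat \<Rightarrow> bool" where
  "evil4 w x y z \<longleftrightarrow> (y < w \<and> w < z \<and> z < x) \<or> (x < z \<and> z < y \<and> y < w) \<or>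
     (y < x \<and> x < z \<and> z < w) \<or> (y < x \<and> x < w \<and> w < z)"

definition evil :: "nat list \<Rightarrow> bool" where
  "evil xs \<longleftrightarrow> (\<exists>i j k l. i < j \<and> j < k \<and> k < l \<and> l < length xs \<and>
     evil4 (xs ! i) (xs ! j) (xs ! k) (xs ! l))"

lemma subseq_Cons_iff_nth:
  "subseq (x # xs) ys \<longleftrightarrow> (\<exists>i<length ys. ys ! i = x \<and> subseq xs (drop (Suc i) ys))"
proof
  assume "subseq (x # xs) ys"
  then obtain us vs where "ys = us @ x # vs" "subseq xs vs"
    by (auto dest: list_emb_ConsD)
  then show "\<exists>i<length ys. ys ! i = x \<and> subseq xs (drop (Suc i) ys)"
    by (intro exI[of _ "length us"]) auto
next
  assume "\<exists>i<length ys. ys ! i = x \<and> subseq xs (drop (Suc i) ys)"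
  then obtain i where i: "i < length ys" "ys ! i = x" "subseq xs (drop (Suc i) ys)"
    by blast
  then have "ys = take i ys @ x # drop (Suc i) ys"
    using id_take_nth_drop by blast
  moreover have "subseq (x # xs) (take i ys @ x # drop (Suc i) ys)"
    using i(3) by (intro list_emb_append2) simp
  ultimately show "subseq (x # xs) ys"
    by simp
qed

lemma subseq4_iff:
  "subseq [w, x, y, z] ys \<longleftrightarrow> (\<exists>i j k l. i < j \<and> j < k \<and> k < l \<and> l < length ys \<and>
     ys ! i = w \<and> ys ! j = x \<and> ys ! k = y \<and> ys ! l = z)"
proof
  assume "subseq [w, x, y, z] ys"
  then obtain i j k l where "i < length ys" "j < length ys - Suc i" "k < length ys - Suc i - Suc j"
    "l < length ys - Suc i - Suc j - Suc k" "ys ! i = w" "drop (Suc i) ys ! j = x"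
    "drop (Suc j) (drop (Suc i) ys) ! k = y" "drop (Suc k) (drop (Suc j) (drop (Suc i) ys)) ! l = z"
    unfolding subseq_Cons_iff_nth length_drop by blast
  then show "\<exists>i j k l. i < j \<and> j < k \<and> k < l \<and> l < length ys \<and>
     ys ! i = w \<and> ys ! j = x \<and> ys ! k = y \<and> ys ! l = z"
    by (intro exI[of _ i] exI[of _ "Suc i + j"] exI[of _ "Suc i + Suc j + k"]
      exI[of _ "Suc i + Suc j + Suc k + l"]) (simp add: algebra_simps)
next
  assume "\<exists>i j k l. i < j \<and> j < k \<and> k < l \<and> l < length ys \<and>
     ys ! i = w \<and> ys ! j = x \<and> ys ! k = y \<and> ys ! l = z"
  then obtain i j k l where *: "i < j" "j < k" "k < l" "l < length ys"
     "ys ! i = w" "ys ! j = x" "ys ! k = y" "ys ! l = z" by blast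
  have "subseq [z] (drop (Suc k) ys)"
    unfolding subseq_Cons_iff_nth using * by (intro exI[of _ "l - Suc k"]) auto
  then have "subseq [y, z] (drop (Suc j) ys)"
    unfolding subseq_Cons_iff_nth[of y] using * by (intro exI[of _ "k - Suc j"]) auto
  then have "subseq [x, y, z] (drop (Suc i) ys)"
    unfolding subseq_Cons_iff_nth[of x] using * by (intro exI[of _ "j - Suc i"]) auto
  then show "subseq [w, x, y, z] ys"
    unfolding subseq_Cons_iff_nth[of w] using * by (intro exI[of _ "i"]) auto
qed

lemma evil_iff_subseq: "evil xs \<longleftrightarrow> (\<exists>w x y z. subseq [w, x, y, z] xs \<and> evil4 w x y z)"
  unfolding evil_def subseq4_iff by blast

lemma contains_pattern4:
  "contains_pattern xs [p, q, r, s] \<longleftrightarrow> (\<exists>w x y z. subseq [w, x, y, z] xs \<and>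
     (\<forall>a<4. \<forall>b<4. [w, x, y, z] ! a < [w, x, y, z] ! b \<longleftrightarrow> [p, q, r, s] ! a < [p, q, r, s] ! b))"
proof -
  have len: "length u = 4 \<longleftrightarrow> (\<exists>w x y z. u = [w, x, y, z])" for u :: "nat list"
    by (auto simp: numeral_eq_Suc length_Suc_conv)
  have "contains_pattern xs [p, q, r, s] \<longleftrightarrow> (\<exists>u. (\<exists>w x y z. u = [w, x, y, z]) \<and> subseq u xs \<and>
     (\<forall>a<4. \<forall>b<4. u ! a < u ! b \<longleftrightarrow> [p, q, r, s] ! a < [p, q, r, s] ! b))"
    unfolding contains_pattern_def len[symmetric] by (rule ex_cong1) auto
  then show ?thesis
    by (elim ssubst) (safe; metis)
qed

lemma all_less_4: "(\<forall>a<4. P a) \<longleftrightarrow> P 0 \<and> P 1 \<and> P 2 \<and> P (3::nat)"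
  by (auto simp: numeral_eq_Suc less_Suc_eq)

lemma contains_evil_patterns:
  "contains_pattern xs [2,4,1,3] \<longleftrightarrow> (\<exists>w x y z. subseq [w, x, y, z] xs \<and> y < w \<and> w < z \<and> z < x)"
  "contains_pattern xs [4,1,3,2] \<longleftrightarrow> (\<exists>w x y z. subseq [w, x, y, z] xs \<and> x < z \<and> z < y \<and> y < w)"
  "contains_pattern xs [4,2,1,3] \<longleftrightarrow> (\<exists>w x y z. subseq [w, x, y, z] xs \<and> y < x \<and> x < z \<and> z < w)"
  "contains_pattern xs [3,2,1,4] \<longleftrightarrow> (\<exists>w x y z. subseq [w, x, y, z] xs \<and> y < x \<and> x < w \<and> w < z)"
  unfolding contains_pattern4 all_less_4
  \<comment> \<open>For a fixed quadruple, the sixteen comparisons collapse to one chain of three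
    strict inequalities.\<close>
  by (-, ((rule ex_cong1)+, rule conj_cong[OF refl], simp, linarith)+)

lemma evil_avoiding_iff: "evil_avoiding xs \<longleftrightarrow> \<not> evil xs"
  unfolding evil_avoiding_def evil_iff_subseq evil4_def ball_simps contains_evil_patterns by blast

lemma evil_subseq: "subseq xs ys \<Longrightarrow> evil xs \<Longrightarrow> evil ys"
  unfolding evil_iff_subseq by (meson subseq_order.order_trans)

lemma evil_map:
  assumes "\<And>x y. g x < g y \<longleftrightarrow> x < (y::nat)"
  shows "evil (map g xs) \<longleftrightarrow> evil xs"
proof -
  have "evil4 (g w) (g x) (g y) (g z) \<longleftrightarrow> evil4 w x y z" for w x y z
    by (simp add: evil4_def assms)
  then show ?thesis
    unfolding evil_def by (intro ex_cong1 conj_cong refl) auto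
qed

text \<open>The head can only be the first letter of an occurrence, so every occurrence either
  avoids the head or starts with it.\<close>

lemma evil_Cons:
  "evil (v # ys) \<longleftrightarrow> evil ys \<or> (\<exists>j k l. j < k \<and> k < l \<and> l < length ys \<and> evil4 v (ys ! j) (ys ! k) (ys ! l))"
    (is "?L \<longleftrightarrow> ?R")
proof
  assume ?L
  then obtain i j k l where *: "i < j" "j < k" "k < l" "l < length (v # ys)"
    "evil4 ((v # ys) ! i) ((v # ys) ! j) ((v # ys) ! k) ((v # ys) ! l)"
    unfolding evil_def by blast
  then obtain j' k' l' where "j = Suc j'" "k = Suc k'" "l = Suc l'"
    by (metis not0_implies_Suc not_less_zero)
  with * show ?R
    by (cases i) (auto simp: evil_def)
next
  assume ?R
  then show ?L
  proof
    assume "evil ys"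
    then show ?L
      by (rule evil_subseq[rotated]) auto
  next
    assume "\<exists>j k l. j < k \<and> k < l \<and> l < length ys \<and> evil4 v (ys ! j) (ys ! k) (ys ! l)"
    then obtain j k l where "j < k" "k < l" "l < length ys" "evil4 v (ys ! j) (ys ! k) (ys ! l)"
      by blast
    then show ?L
      unfolding evil_def
      by (intro exI[of _ 0] exI[of _ "Suc j"] exI[of _ "Suc k"] exI[of _ "Suc l"]) auto
  qed
qed

text \<open>In each of the four patterns the third letter is smaller than the first, so a minimal
  head starts no occurrence.\<close>

lemma evil_Cons_min:
  assumes "\<And>y. y \<in> set ys \<Longrightarrow> v < y"
  shows "evil (v # ys) \<longleftrightarrow> evil ys"
proof -
  have "v < ys ! i" if "i < length ys" for i
    using assms that by simp
  then show ?thesis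
    unfolding evil_Cons evil4_def by (meson order.strict_trans order.asym)
qed

lemma evil_upt_append:
  assumes "\<And>y. y \<in> set ys \<Longrightarrow> q \<le> y"
  shows "evil ([p..<q] @ ys) \<longleftrightarrow> evil ys"
proof (induction "q - p" arbitrary: p)
  case 0
  then show ?case by simp
next
  case (Suc d)
  then have "evil ([Suc p..<q] @ ys) \<longleftrightarrow> evil ys"
    by simp
  moreover have "evil (p # [Suc p..<q] @ ys) \<longleftrightarrow> evil ([Suc p..<q] @ ys)"
    using assms Suc(2) by (intro evil_Cons_min) force
  ultimately show ?case
    using Suc(2) by (simp add: upt_conv_Cons)
qed

text \<open>Each pattern has its first or its second letter below its last. An occurrence ending in
  the appended run would have that letter in the run too and would increase from there to its end,
  which no pattern does.\<close>

lemma evil_skew_append_upt: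
  assumes "\<And>x. x \<in> set xs \<Longrightarrow> q \<le> x" and "evil (xs @ [p..<q])"
  shows "evil xs"
proof -
  let ?ys = "xs @ [p..<q]"
  obtain i j k l where *: "i < j" "j < k" "k < l" "l < length ?ys"
    "evil4 (?ys ! i) (?ys ! j) (?ys ! k) (?ys ! l)"
    using assms(2) unfolding evil_def by blast
  have big: "q \<le> ?ys ! r" if "r < length xs" for r
    using that assms(1) by (simp add: nth_append)
  have small: "?ys ! r < q" if "r \<ge> length xs" "r < length ?ys" for r
    using that by (simp add: nth_append)
  have mono: "?ys ! r < ?ys ! s" if "r \<ge> length xs" "s < length ?ys" "r < s" for r s
    using that by (simp add: nth_append)
  show ?thesis
  proof (cases "l < length xs")
    case True
    then show ?thesis
      using * unfolding evil_def
      by (intro exI[of _ i] exI[of _ j] exI[of _ k] exI[of _ l]) (auto simp: nth_append)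
  next
    case False
    have l: "?ys ! l < q"
      using small[of l] False * by simp
    have jl: "?ys ! j < ?ys ! l \<Longrightarrow> length xs \<le> j"
      using l big[of j] by linarith
    have jk: "length xs \<le> j \<Longrightarrow> ?ys ! j < ?ys ! k \<and> ?ys ! k < ?ys ! l"
      using mono[of j k] mono[of k l] * by auto
    have il: "?ys ! i < ?ys ! l \<Longrightarrow> length xs \<le> j \<and> ?ys ! i < ?ys ! j"
      using l big[of i] mono[of i j] * by fastforce
    show ?thesis
      using *(5) jl jk il unfolding evil4_def by linarith
  qed
qed

section \<open>The code of the inverse permutation\<close>

text \<open>The Lehmer code of the inverse permutation has \<open>larger_before v \<pi>\<close> as its entry at
  position \<open>v\<close>, which makes it computable along the one-line form of \<open>\<pi>\<close>.\<close>

definition larger_before :: "nat \<Rightarrow> nat list \<Rightarrow> nat" where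
  "larger_before v xs = length (filter (\<lambda>w. v < w) (takeWhile (\<lambda>w. w \<noteq> v) xs))"

definition inv_code :: "nat list \<Rightarrow> nat list" where
  "inv_code xs = map (\<lambda>v. larger_before v xs) [1..<Suc (length xs)]"

lemma larger_before_Nil [simp]: "larger_before v [] = 0"
  by (simp add: larger_before_def)

lemma larger_before_Cons [simp]:
  "larger_before v (x # xs) =
     (if x = v then 0 else (if v < x then 1 else 0) + larger_before v xs)"
  unfolding larger_before_def by (cases "x = v"; cases "v < x") simp_all

lemma larger_before_append:
  "larger_before v (xs @ ys) =
     (if v \<in> set xs then larger_before v xs else length (filter (\<lambda>w. v < w) xs) + larger_before v ys)"
  by (induction xs) auto

lemma larger_before_map:
  assumes "\<And>x y. g x < g y \<longleftrightarrow> x < (y::nat)"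
  shows "larger_before (g v) (map g xs) = larger_before v xs"
proof -
  have "g x = g y \<longleftrightarrow> x = y" for x y
    using assms by (metis linorder_neq_iff order_less_irrefl)
  then show ?thesis
    using assms by (induction xs) auto
qed

lemma larger_before_upt: "p \<le> v \<Longrightarrow> larger_before v [p..<q] = 0"
proof (induction "q - p" arbitrary: p)
  case (Suc d)
  then have "larger_before v [Suc p..<q] = 0" if "p \<noteq> v"
    using that by simp
  with Suc show ?case
    by (auto simp: upt_conv_Cons)
qed simp

lemma larger_before_filter:
  "t < v \<Longrightarrow> larger_before v (filter (\<lambda>w. t < w) xs) = larger_before v xs"
  by (induction xs) auto

lemma larger_before_less:
  "v \<in> set xs \<Longrightarrow> larger_before v xs < length xs"
  by (induction xs) (auto simp: less_Suc_eq)

lemma length_inv_code [simp]: "length (inv_code xs) = length xs"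
  by (simp add: inv_code_def del: upt_Suc)

lemma nth_inv_code: "i < length xs \<Longrightarrow> inv_code xs ! i = larger_before (Suc i) xs"
  by (simp add: inv_code_def del: upt_Suc)

section \<open>The inverse permutation and its Lehmer code\<close>

lemma length_perm_inv [simp]: "length (perm_inv xs) = length xs"
  by (simp add: perm_inv_def del: upt_Suc)

text \<open>Values and positions count from \<open>1\<close>, list indices from \<open>0\<close>;
  hence the \<open>- 1\<close> on the value and the \<open>Suc\<close> on the position.\<close>

lemma perm_inv_nth:
  assumes "xs \<in> Sym n" "j < n"
  shows "perm_inv xs ! (xs ! j - 1) = Suc j"
proof -
  have len: "length xs = n" and "xs ! j \<in> set xs" and "distinct xs"
    using assms by (auto simp: Sym_def)
  then have v: "xs ! j \<in> {1..n}"
    using assms by (auto simp: Sym_def)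
  have "(LEAST i. i < length xs \<and> xs ! i = xs ! j) = j"
    using \<open>distinct xs\<close> len assms(2) by (intro Least_equality) (auto simp: nth_eq_iff_index_eq)
  then show ?thesis
    using v len unfolding perm_inv_def by (subst nth_map) (auto simp del: upt_Suc)
qed

lemma perm_inv_nthE:
  assumes "xs \<in> Sym n" "i < n"
  obtains j where "j < n" "xs ! j = Suc i" "perm_inv xs ! i = Suc j"
proof -
  have "Suc i \<in> set xs" "length xs = n"
    using assms by (auto simp: Sym_def)
  then obtain j where "j < n" "xs ! j = Suc i"
    by (metis in_set_conv_nth)
  with perm_inv_nth[OF assms(1) this(1)] that show ?thesis
    by simp
qed

lemma inj_on_perm_inv: "inj_on perm_inv (Sym n)"
proof (rule inj_onI)
  fix xs ys assume *: "xs \<in> Sym n" "ys \<in> Sym n" "perm_inv xs = perm_inv ys"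
  show "xs = ys"
  proof (rule nth_equalityI)
    show "length xs = length ys"
      using * by (simp add: Sym_def)
    fix j assume "j < length xs"
    then have j: "j < n" and "xs ! j \<in> set xs"
      using * by (auto simp: Sym_def)
    then have v: "1 \<le> xs ! j" "xs ! j \<le> n"
      using * by (auto simp: Sym_def)
    then obtain i where "i < n" "ys ! i = Suc (xs ! j - 1)" "perm_inv ys ! (xs ! j - 1) = Suc i"
      using perm_inv_nthE[OF *(2), of "xs ! j - 1"] by (metis One_nat_def Suc_le_eq Suc_pred order_less_le_trans lessI)
    then show "xs ! j = ys ! j"
      using perm_inv_nth[OF *(1) j] *(3) v by simp
  qed
qed

lemma perm_inv_permutes:
  assumes "xs \<in> Sym n"
  shows "distinct (perm_inv xs)" "set (perm_inv xs) = {1..n}"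
proof -
  have len: "length xs = n"
    using assms by (simp add: Sym_def)
  show "distinct (perm_inv xs)"
    unfolding distinct_conv_nth using perm_inv_nthE[OF assms] len
    by (metis Suc_inject length_perm_inv)
  have "set (perm_inv xs) \<subseteq> {1..n}"
  proof
    fix y assume "y \<in> set (perm_inv xs)"
    then obtain i where "i < n" "y = perm_inv xs ! i"
      using len by (metis in_set_conv_nth length_perm_inv)
    then show "y \<in> {1..n}"
      using perm_inv_nthE[OF assms, of i] by (metis Suc_le_eq atLeastAtMost_iff le_add1 plus_1_eq_Suc)
  qed
  then show "set (perm_inv xs) = {1..n}"
    using \<open>distinct (perm_inv xs)\<close> len
    by (metis card_atLeastAtMost card_subset_eq diff_Suc_1 distinct_card finite_atLeastAtMost length_perm_inv)
qed

text \<open>Makes the code recursive along the list. Distinctness turns a count of positions into a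
  count of values, which depends only on the set of the remaining entries.\<close>

lemma lehmer_Cons: "distinct (x # xs) \<Longrightarrow> lehmer (x # xs) = card {y \<in> set xs. y < x} # lehmer xs"
proof -
  assume d: "distinct (x # xs)"
  have "[0..<length (x # xs)] = 0 # map Suc [0..<length xs]"
    by (simp add: upt_conv_Cons map_Suc_upt del: upt_Suc)
  moreover have "card {j. 0 < j \<and> j < length (x # xs) \<and> (x # xs) ! j < (x # xs) ! 0} = card {y \<in> set xs. y < x}"
  proof -
    have "{j. 0 < j \<and> j < length (x # xs) \<and> (x # xs) ! j < (x # xs) ! 0} = Suc ` {i. i < length xs \<and> xs ! i < x}"
      by (auto simp: gr0_conv_Suc)
    moreover have "{y \<in> set xs. y < x} = (!) xs ` {i. i < length xs \<and> xs ! i < x}"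
      by (auto simp: in_set_conv_nth)
    moreover have "inj_on ((!) xs) {i. i < length xs \<and> xs ! i < x}"
      using d by (intro inj_on_nth) auto
    ultimately show ?thesis
      by (simp add: card_image)
  qed
  moreover have "card {j. Suc i < j \<and> j < length (x # xs) \<and> (x # xs) ! j < (x # xs) ! Suc i} =
    card {j. i < j \<and> j < length xs \<and> xs ! j < xs ! i}" for i
  proof -
    have "{j. Suc i < j \<and> j < length (x # xs) \<and> (x # xs) ! j < (x # xs) ! Suc i} =
      Suc ` {j. i < j \<and> j < length xs \<and> xs ! j < xs ! i}"
      by (auto simp: image_iff Suc_less_eq2)
    then show ?thesis
      by (simp add: card_image)
  qed
  ultimately show ?thesis
    unfolding lehmer_def by (simp del: upt_Suc)
qed

text \<open>The first code entry is the rank of the head in the common set of entries and so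
  determines the head; the tails then share both their set and their code.\<close>

lemma lehmer_inj:
  assumes "distinct xs" "distinct ys" "set xs = set ys" "lehmer xs = lehmer ys"
  shows "xs = ys"
  using assms
proof (induction xs arbitrary: ys)
  case (Cons x xs)
  then obtain y ys' where ys: "ys = y # ys'"
    by (cases ys) auto
  have *: "{z \<in> set xs. z < x} = {z \<in> set ys. z < x}" "{z \<in> set ys'. z < y} = {z \<in> set ys. z < y}"
    using Cons.prems(3) ys by auto
  have c: "card {z \<in> set ys. z < x} = card {z \<in> set ys. z < y}" and l: "lehmer xs = lehmer ys'"
    using Cons.prems ys by (simp_all add: lehmer_Cons * del: distinct.simps set_simps)
  have lt: "card {z \<in> set ys. z < u} < card {z \<in> set ys. z < v}" if "u < v" "u \<in> set ys" for u v
    using that by (intro psubset_card_mono) auto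
  have "x \<in> set ys" "y \<in> set ys"
    using Cons.prems(3) ys by auto
  then have "x = y"
    using lt[of x y] lt[of y x] c by linarith
  moreover have "set xs = set ys'"
    using Cons.prems ys \<open>x = y\<close> by auto
  ultimately show ?case
    using Cons.IH[of ys'] Cons.prems ys l by auto
qed simp

lemma mem_takeWhile_iff:
  assumes "distinct xs" "i < length xs" "j < length xs"
  shows "xs ! j \<in> set (takeWhile (\<lambda>w. w \<noteq> xs ! i) xs) \<longleftrightarrow> j < i"
proof -
  have "takeWhile (\<lambda>w. w \<noteq> xs ! i) xs = take i xs"
    using assms by (intro takeWhile_eq_take_P_nth) (auto simp: nth_eq_iff_index_eq)
  then show ?thesis
    using assms by (auto simp: in_set_conv_nth nth_eq_iff_index_eq)
qed

text \<open>\<open>Suc j\<close> stands before \<open>Suc i\<close> in \<open>xs\<close> iff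
  \<open>perm_inv xs ! j < perm_inv xs ! i\<close>, so \<open>Suc\<close> maps the counted indices
  bijectively onto the larger values before \<open>Suc i\<close>.\<close>

lemma larger_before_card:
  assumes "xs \<in> Sym n" "i < n"
  shows "larger_before (Suc i) xs = card {j. i < j \<and> j < n \<and> perm_inv xs ! j < perm_inv xs ! i}"
proof -
  have d: "distinct xs" and len: "length xs = n" and s: "set xs = {1..n}"
    using assms by (auto simp: Sym_def)
  let ?A = "set (filter (\<lambda>w. Suc i < w) (takeWhile (\<lambda>w. w \<noteq> Suc i) xs))"
  obtain p where p: "p < n" "xs ! p = Suc i" "perm_inv xs ! i = Suc p"
    using perm_inv_nthE assms by blast
  have "?A = Suc ` {j. i < j \<and> j < n \<and> perm_inv xs ! j < perm_inv xs ! i}" (is "_ = Suc ` ?B")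
  proof (rule set_eqI)
    fix w
    show "w \<in> ?A \<longleftrightarrow> w \<in> Suc ` ?B"
    proof (cases "w \<in> {1..n}")
      case True
      then obtain j where j: "w = Suc j" "j < n"
        by (cases w) auto
      obtain q where q: "q < n" "xs ! q = Suc j" "perm_inv xs ! j = Suc q"
        using perm_inv_nthE assms(1) j(2) by blast
      show ?thesis
        using mem_takeWhile_iff[OF d, of p q] p q j len by auto
    next
      case False
      then show ?thesis
        using s by (auto dest: set_takeWhileD)
    qed
  qed
  moreover have "larger_before (Suc i) xs = card ?A"
    unfolding larger_before_def using d by (intro distinct_card[symmetric]) (simp add: distinct_takeWhile)
  ultimately show ?thesis
    by (simp add: card_image)
qed

lemma lehmer_perm_inv: "xs \<in> Sym n \<Longrightarrow> lehmer (perm_inv xs) = inv_code xs"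
  unfolding lehmer_def
  by (rule nth_equalityI) (auto simp: nth_inv_code larger_before_card Sym_def)

lemma inj_on_inv_code: "inj_on inv_code (Sym n)"
proof (rule inj_onI)
  fix xs ys assume *: "xs \<in> Sym n" "ys \<in> Sym n" "inv_code xs = inv_code ys"
  then have "lehmer (perm_inv xs) = lehmer (perm_inv ys)"
    using lehmer_perm_inv by metis
  moreover have "set (perm_inv xs) = set (perm_inv ys)"
    using *(1,2) perm_inv_permutes(2) by metis
  ultimately have "perm_inv xs = perm_inv ys"
    using *(1,2) perm_inv_permutes(1) lehmer_inj by blast
  then show "xs = ys"
    using inj_onD[OF inj_on_perm_inv] *(1,2) by blast
qed

lemma inv_code_le:
  assumes "xs \<in> Sym n" "i < n"
  shows "inv_code xs ! i \<le> n - 1 - i"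
proof -
  have "inv_code xs ! i = card {j. i < j \<and> j < n \<and> perm_inv xs ! j < perm_inv xs ! i}"
    using assms by (simp add: nth_inv_code larger_before_card Sym_def)
  also have "\<dots> \<le> card {i<..<n}"
    by (intro card_mono) auto
  finally show ?thesis
    by simp
qed

section \<open>Descents of the code and recoils of the permutation\<close>

definition descents :: "nat list \<Rightarrow> nat list" where
  "descents c = filter (\<lambda>i. c ! i < c ! (i - 1)) [1..<length c]"

text \<open>If the inverse descends, the set counted at \<open>Suc i\<close> is a proper subset of
  the one counted at \<open>i\<close>, with \<open>Suc i\<close> as an extra element of the latter.
  If it ascends, the inclusion goes the other way.\<close>

lemma inv_code_descent_iff:
  assumes "xs \<in> Sym n" "Suc i < n"
  shows "inv_code xs ! Suc i < inv_code xs ! i \<longleftrightarrow> perm_inv xs ! Suc i < perm_inv xs ! i"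
proof -
  let ?p = "perm_inv xs"
  let ?S = "\<lambda>i. {j. i < j \<and> j < n \<and> ?p ! j < ?p ! i}"
  have S: "inv_code xs ! i = card (?S i)" if "i < n" for i
    using assms(1) that by (simp add: nth_inv_code larger_before_card Sym_def)
  have ne: "?p ! Suc i \<noteq> ?p ! i"
    using perm_inv_permutes(1)[OF assms(1)] assms by (auto simp: nth_eq_iff_index_eq Sym_def)
  show ?thesis
  proof (cases "?p ! Suc i < ?p ! i")
    case True
    then have "?S (Suc i) \<subset> ?S i"
      using assms(2) by auto
    then show ?thesis
      using True S assms(2) by (simp add: psubset_card_mono)
  next
    case False
    have "j \<in> ?S (Suc i)" if "j \<in> ?S i" for j
    proof -
      have "j \<noteq> Suc i"
        using that False by auto
      then show ?thesis
        using that ne False by auto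
    qed
    then have "?S i \<subseteq> ?S (Suc i)"
      by blast
    then show ?thesis
      using False S assms(2) by (simp add: card_mono not_less)
  qed
qed

lemma recoils_eq_descents:
  assumes "xs \<in> Sym n"
  shows "recoils xs = set (descents (inv_code xs))"
proof -
  have len: "length xs = n"
    using assms by (simp add: Sym_def)
  have "inv_code xs ! i < inv_code xs ! (i - 1) \<longleftrightarrow> perm_inv xs ! i < perm_inv xs ! (i - 1)"
    if "1 \<le> i" "i < n" for i
    using inv_code_descent_iff[OF assms, of "i - 1"] that by simp
  then show ?thesis
    unfolding recoils_def descents_def by (auto simp: len)
qed

lemma card_recoils: "xs \<in> Sym n \<Longrightarrow> card (recoils xs) = length (descents (inv_code xs))"
  by (simp add: recoils_eq_descents distinct_card descents_def del: set_filter)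

section \<open>Partitions from codes\<close>

lemma drop_trailing_zeros_Cons: "0 < x \<Longrightarrow> drop_trailing_zeros (x # xs) = x # drop_trailing_zeros xs"
proof -
  assume "0 < x"
  then have "dropWhile (\<lambda>x. x = 0) (ys @ [x]) = dropWhile (\<lambda>x. x = 0) ys @ [x]" for ys
    by (induction ys) auto
  then show ?thesis
    by (simp add: drop_trailing_zeros_def)
qed

lemma drop_trailing_zeros_replicate:
  "0 < x \<Longrightarrow> drop_trailing_zeros (replicate s x @ xs) = replicate s x @ drop_trailing_zeros xs"
  by (induction s) (simp_all add: drop_trailing_zeros_Cons)

lemma drop_trailing_zeros_zeros [simp]: "drop_trailing_zeros (replicate b 0) = []"
  by (simp add: drop_trailing_zeros_def)

lemma drop_trailing_zeros_append_zeros: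
  obtains b where "xs = drop_trailing_zeros xs @ replicate b 0"
proof -
  have "rev xs = takeWhile (\<lambda>x. x = 0) (rev xs) @ dropWhile (\<lambda>x. x = 0) (rev xs)"
    by simp
  moreover have "takeWhile (\<lambda>x. x = 0) (rev xs) = replicate (length (takeWhile (\<lambda>x. x = 0) (rev xs))) 0"
    by (intro replicate_eqI) (auto dest: set_takeWhileD)
  ultimately have "rev (rev xs) = rev (dropWhile (\<lambda>x. x = 0) (rev xs)) @
      rev (replicate (length (takeWhile (\<lambda>x. x = 0) (rev xs))) 0)"
    by (metis rev_append)
  then show ?thesis
    using that unfolding drop_trailing_zeros_def by simp
qed

text \<open>The common length fixes the number of zeros that were stripped.\<close>

lemma drop_trailing_zeros_inj:
  assumes "drop_trailing_zeros xs = drop_trailing_zeros ys" "length xs = length ys"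
  shows "xs = ys"
proof -
  obtain b where b: "xs = drop_trailing_zeros xs @ replicate b 0"
    by (rule drop_trailing_zeros_append_zeros)
  obtain b' where b': "ys = drop_trailing_zeros ys @ replicate b' 0"
    by (rule drop_trailing_zeros_append_zeros)
  have "b = b'"
    using arg_cong[OF b, of length] arg_cong[OF b', of length] assms by simp
  then show ?thesis
    using b b' assms(1) by simp
qed

lemma set_descents: "set (descents c) = {i. 1 \<le> i \<and> i < length c \<and> c ! i < c ! (i - 1)}"
  by (auto simp: descents_def)

text \<open>A descent at \<open>r\<close> compares the indices \<open>r - 1\<close> and
  \<open>r\<close>, hence the half-open range for \<open>r\<close>.\<close>

lemma descents_mono:
  assumes "\<And>r. j < r \<Longrightarrow> r \<le> k \<Longrightarrow> r \<notin> set (descents c)" "j \<le> k" "k < length c"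
  shows "c ! j \<le> c ! k"
  using assms
proof (induction "k - j" arbitrary: k)
  case (Suc d)
  then have "c ! j \<le> c ! (k - 1)"
    by (intro Suc(1)) auto
  also have "\<dots> \<le> c ! k"
    using Suc(2) Suc(3)[of k] Suc(5) by (simp add: set_descents not_less)
  finally show ?case .
qed simp

lemma descents_sorted: "sorted xs \<Longrightarrow> descents xs = []"
  by (auto simp: descents_def filter_empty_conv not_less sorted_iff_nth_mono)

lemma descents_append:
  assumes "xs \<noteq> []" "ys \<noteq> []"
  shows "descents (xs @ ys) = descents xs @ (if hd ys < last xs then [length xs] else []) @
    map (\<lambda>i. i + length xs) (descents ys)"
proof -
  have "[1..<length (xs @ ys)] = [1..<length xs] @ [length xs] @ map (\<lambda>i. i + length xs) [1..<length ys]"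
  proof -
    have "[1..<length (xs @ ys)] = [1..<length xs] @ [length xs..<length xs + length ys]"
      using assms(1) upt_add_eq_append[of 1 "length xs" "length ys"] by (simp add: Suc_le_eq)
    also have "[length xs..<length xs + length ys] = [length xs] @ [Suc (length xs)..<length xs + length ys]"
      using assms(2) by (simp add: upt_conv_Cons)
    also have "[Suc (length xs)..<length xs + length ys] = map (\<lambda>i. i + length xs) [1..<length ys]"
      by (rule nth_equalityI) auto
    finally show ?thesis .
  qed
  moreover have "filter (\<lambda>i. (xs @ ys) ! i < (xs @ ys) ! (i - 1)) [1..<length xs] = descents xs"
    unfolding descents_def by (rule filter_cong) (auto simp: nth_append)
  moreover have "filter (\<lambda>i. (xs @ ys) ! i < (xs @ ys) ! (i - 1)) [length xs] =
      (if hd ys < last xs then [length xs] else [])"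
    using assms by (simp add: nth_append last_conv_nth hd_conv_nth)
  moreover have "filter (\<lambda>i. (xs @ ys) ! i < (xs @ ys) ! (i - 1)) (map (\<lambda>i. i + length xs) [1..<length ys]) =
      map (\<lambda>i. i + length xs) (descents ys)"
    unfolding descents_def filter_map
    by (rule arg_cong[where f = "map _"], rule filter_cong) (auto simp: nth_append)
  ultimately show ?thesis
    by (simp only: descents_def[of "xs @ ys"] filter_append)
qed

lemma descents_Cons_zero: "descents (0 # ys) = map Suc (descents ys)"
proof (cases "ys = []")
  case False
  then show ?thesis
    using descents_append[of "[0]" ys] by (simp add: descents_def)
qed (simp add: descents_def)

text \<open>For consecutive descents \<open>p\<close> and \<open>q\<close> of \<open>c\<close> (with
  \<open>p = 0\<close> for the first one), this is one partition of the sequence given by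
  \<open>P\<close>.\<close>

definition block :: "nat \<Rightarrow> nat list \<Rightarrow> nat \<Rightarrow> nat \<Rightarrow> nat list" where
  "block n c p q = drop_trailing_zeros (map (\<lambda>j. (n - q) - (if j < p then 0 else c ! j)) [0..<q])"

text \<open>\<open>blocks xs ys\<close> collects the partitions that the code \<open>xs @ ys\<close> yields for the descents
  inside \<open>ys\<close>, as if the last descent before them were at \<open>length xs\<close>. Apart from the length of
  \<open>xs\<close> it only depends on \<open>ys\<close>, so lengthening \<open>xs\<close> just duplicates first parts.\<close>

definition blocks :: "nat list \<Rightarrow> nat list \<Rightarrow> nat list list" where
  "blocks xs ys = (let a = map (\<lambda>i. i + length xs) (descents ys)
     in map2 (block (length (xs @ ys)) (xs @ ys)) (length xs # a) a)"

lemma length_blocks [simp]: "length (blocks xs ys) = length (descents ys)"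
  by (simp add: blocks_def Let_def)

lemma KW_P_eq_blocks:
  assumes "\<pi> \<in> Sym n"
  shows "KW_P \<pi> = blocks [] (inv_code \<pi>)"
proof -
  have len: "length \<pi> = length (inv_code \<pi>)"
    by simp
  have "KW_P \<pi> = map (\<lambda>i. block (length \<pi>) (inv_code \<pi>) ((0 # descents (inv_code \<pi>)) ! i)
      (descents (inv_code \<pi>) ! i)) [0..<length (descents (inv_code \<pi>))]"
    unfolding KW_P_def Let_def lehmer_perm_inv[OF assms] block_def descents_def len by simp
  also have "\<dots> = blocks [] (inv_code \<pi>)"
    unfolding blocks_def Let_def by (rule nth_equalityI) simp_all
  finally show ?thesis .
qed

text \<open>Nothing is subtracted from the first entry, so the first part is \<open>n - q\<close>,
  which is positive and survives the stripping.\<close>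

lemma block_Cons:
  assumes "0 < q" "q < n" "0 < p \<or> c ! 0 = 0"
  shows "block n c p q =
    (n - q) # drop_trailing_zeros (map (\<lambda>j. (n - q) - (if j < p then 0 else c ! j)) [1..<q])"
  using assms unfolding block_def by (auto simp: upt_conv_Cons drop_trailing_zeros_Cons simp del: upt_Suc)

text \<open>The size, the prefix length and the descent all grow by \<open>s\<close>, so their
  differences stay the same. No entry of the prefix is read, and \<open>s\<close> further
  unsubtracted entries appear in front.\<close>

lemma block_shift:
  assumes "length xs' = length xs + s" "xs \<noteq> []" "q + length xs < n"
  shows "block (n + s) (xs' @ ys) (p + length xs') (q + length xs') =
    replicate s (n - (q + length xs)) @ block n (xs @ ys) (p + length xs) (q + length xs)"
proof -
  have "[0..<q + length xs'] = [0..<s] @ map (\<lambda>j. j + s) [0..<q + length xs]"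
    using upt_add_eq_append[of 0 s "q + length xs"] assms(1)
    by (simp add: map_add_upt add.commute add.left_commute)
  moreover have "map (\<lambda>j. (n + s - (q + length xs')) -
      (if j < p + length xs' then 0 else (xs' @ ys) ! j)) [0..<s] = replicate s (n - (q + length xs))"
    using assms(1) by (intro nth_equalityI) auto
  moreover have "map (\<lambda>j. (n + s - (q + length xs')) -
      (if j < p + length xs' then 0 else (xs' @ ys) ! j)) (map (\<lambda>j. j + s) [0..<q + length xs]) =
      map (\<lambda>j. (n - (q + length xs)) -
      (if j < p + length xs then 0 else (xs @ ys) ! j)) [0..<q + length xs]"
    using assms(1) by (auto simp: nth_append)
  ultimately have "map (\<lambda>j. (n + s - (q + length xs')) -
      (if j < p + length xs' then 0 else (xs' @ ys) ! j)) [0..<q + length xs'] =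
      replicate s (n - (q + length xs)) @ map (\<lambda>j. (n - (q + length xs)) -
      (if j < p + length xs then 0 else (xs @ ys) ! j)) [0..<q + length xs]"
    by (simp only: map_append)
  then show ?thesis
    using assms(3) unfolding block_def by (simp only: drop_trailing_zeros_replicate zero_less_diff)
qed

lemma blocks_shift:
  assumes "length xs' = length xs + s" "xs \<noteq> []"
  shows "blocks xs' ys = map (\<lambda>l. replicate s (hd l) @ l) (blocks xs ys)"
proof (rule nth_equalityI)
  fix i assume "i < length (blocks xs' ys)"
  then have i: "i < length (descents ys)"
    by simp
  \<comment> \<open>The \<open>0\<close> in front of the descents stands for the end of the
    prefix.\<close>
  define p q where "p = (0 # descents ys) ! i" and "q = descents ys ! i"
  have "q \<in> set (descents ys)"
    using i by (simp add: q_def)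
  then have q: "q < length ys"
    by (simp add: set_descents)
  have nth: "blocks zs ys ! i = block (length zs + length ys) (zs @ ys) (p + length zs) (q + length zs)" for zs
    using i by (auto simp: blocks_def Let_def p_def q_def nth_Cons split: nat.split)
  have "blocks xs' ys ! i = block (length xs + length ys + s) (xs' @ ys) (p + length xs') (q + length xs')"
    by (simp add: nth assms(1) algebra_simps)
  also have "\<dots> = replicate s (length xs + length ys - (q + length xs)) @ blocks xs ys ! i"
    unfolding nth using assms q by (intro block_shift) auto
  \<comment> \<open>As \<open>xs\<close> is nonempty, the block starts with an unsubtracted entry,
    so the duplicated number is its first part.\<close>
  also have "length xs + length ys - (q + length xs) = hd (blocks xs ys ! i)"
    unfolding nth using assms q by (subst block_Cons) auto
  finally show "blocks xs' ys ! i = map (\<lambda>l. replicate s (hd l) @ l) (blocks xs ys) ! i"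
    using i by simp
qed simp

text \<open>No descent follows a leading \<open>0\<close>, and prefix entries are read as
  \<open>0\<close> anyway, so this entry may be moved into the prefix.\<close>

lemma blocks_Cons_zero: "blocks xs (0 # ys) = blocks (xs @ [0]) ys"
proof (cases "descents ys")
  case (Cons q qs)
  have "block n (xs @ 0 # ys) (length xs) r = block n (xs @ 0 # ys) (Suc (length xs)) r" for n r
    unfolding block_def by (intro arg_cong[where f = drop_trailing_zeros] map_cong) (auto simp: nth_append less_Suc_eq)
  then show ?thesis
    using Cons by (simp add: blocks_def descents_Cons_zero o_def)
qed (simp add: blocks_def descents_Cons_zero)

text \<open>A sorted prefix has no descent of its own, so the first descent is the one at the
  junction.\<close>

lemma blocks_descent:
  assumes "sorted xs" "xs \<noteq> []" "ys \<noteq> []" "hd ys < last xs"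
  shows "blocks [] (xs @ ys) = block (length (xs @ ys)) (xs @ ys) 0 (length xs) # blocks xs ys"
  using assms by (simp add: blocks_def descents_append descents_sorted Let_def)

text \<open>The first part of the \<open>i\<close>-th partition is \<open>n - a\<^sub>i\<close>, which recovers the descents; the code is
  then read off block by block and vanishes after the last descent.\<close>

lemma blocks_inj:
  assumes len: "length c = n" "length c' = n"
    and zero: "c ! 0 = 0" "c' ! 0 = 0"
    and le: "\<And>i. i < n \<Longrightarrow> c ! i \<le> n - 1 - i" "\<And>i. i < n \<Longrightarrow> c' ! i \<le> n - 1 - i"
    and eq: "blocks [] c = blocks [] c'"
  shows "c = c'"
proof -
  have nth: "blocks [] d ! i = block n d ((0 # descents d) ! i) (descents d ! i)"
    if "i < length (descents d)" "length d = n" for d i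
    using that by (simp add: blocks_def Let_def)
  have rng: "0 < descents d ! i" "descents d ! i < n" if "i < length (descents d)" "length d = n" for d i
    using that set_descents[of d] nth_mem[of i "descents d"] by auto
  have hd: "n - hd (blocks [] d ! i) = descents d ! i"
    if "i < length (descents d)" "length d = n" "d ! 0 = 0" for d i
    using that rng[of i d] by (simp add: nth block_Cons)
  have desc_eq: "descents c = descents c'"
  proof (rule nth_equalityI)
    show lens: "length (descents c) = length (descents c')"
      using eq by (metis length_blocks)
    fix i assume "i < length (descents c)"
    then show "descents c ! i = descents c' ! i"
      using hd[of i c] hd[of i c'] lens eq len zero by simp
  qed
  define a where "a = descents c"
  have sorted_a: "sorted_wrt (<) a"
    unfolding a_def descents_def by (intro sorted_wrt_filter sorted_wrt_upt)
  have "c ! j = c' ! j" if j: "j < n" for j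
  proof (cases "\<exists>i<length a. j < a ! i")
    case True
    \<comment> \<open>The index of the block that reads position \<open>j\<close>, between the
      descents \<open>p\<close> and \<open>q\<close>.\<close>
    define i where "i = (LEAST i. i < length a \<and> j < a ! i)"
    have i: "i < length a" "j < a ! i"
      using LeastI_ex[of "\<lambda>i. i < length a \<and> j < a ! i"] True by (auto simp: i_def)
    have least: "\<not> j < a ! r" if "r < i" for r
      using not_less_Least[of r "\<lambda>i. i < length a \<and> j < a ! i"] that i by (auto simp: i_def)
    define p q where "p = (0 # a) ! i" and "q = a ! i"
    have pj: "p \<le> j"
      using least[of "i - 1"] by (cases i) (auto simp: p_def)
    have nodesc: "r \<notin> set a" if "j < r" "r < q" for r
    proof
      assume "r \<in> set a"
      then obtain u where u: "u < length a" "a ! u = r"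
        by (auto simp: in_set_conv_nth)
      have "\<not> i \<le> u"
        using sorted_wrt_nth_less[OF sorted_a, of i u] u that i by (cases "i = u") (auto simp: q_def)
      then show False
        using least[of u] u that by auto
    qed
    have q: "q < n"
      using rng[of i c] i len by (simp add: a_def q_def)
    \<comment> \<open>Subtraction truncates at \<open>0\<close>; only below \<open>n - q\<close>
      does the difference determine the code entry. The code increases weakly up to index
      \<open>q - 1\<close>, where it is at most \<open>n - q\<close>.\<close>
    have bound: "d ! j \<le> n - q" if "length d = n" "descents d = a"
      "\<And>i. i < n \<Longrightarrow> d ! i \<le> n - 1 - i" for d
    proof -
      have "d ! j \<le> d ! (q - 1)"
        using nodesc i that q by (intro descents_mono) (auto simp: q_def)
      also have "\<dots> \<le> n - q"
        using that(3)[of "q - 1"] q i by (simp add: q_def)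
      finally show ?thesis .
    qed
    have "block n c p q = block n c' p q"
      using nth[of i c] nth[of i c'] eq desc_eq len i by (simp add: p_def q_def a_def)
    then have "map (\<lambda>j. (n - q) - (if j < p then 0 else c ! j)) [0..<q] =
        map (\<lambda>j. (n - q) - (if j < p then 0 else c' ! j)) [0..<q]"
      unfolding block_def by (rule drop_trailing_zeros_inj) simp
    then have "(n - q) - c ! j = (n - q) - c' ! j"
      using pj i by (auto simp: q_def dest!: bspec[of _ _ j])
    then show ?thesis
      using bound[of c] bound[of c'] len le desc_eq by (simp add: a_def)
  next
    case False
    \<comment> \<open>After the last descent the code increases weakly towards its last entry, which
      is at most \<open>0\<close>.\<close>
    have "d ! j = 0" if "length d = n" "descents d = a"
      "\<And>i. i < n \<Longrightarrow> d ! i \<le> n - 1 - i" for d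
    proof -
      have "d ! j \<le> d ! (n - 1)"
        using False j that by (intro descents_mono) (auto simp: in_set_conv_nth)
      then show ?thesis
        using that(3)[of "n - 1"] j by simp
    qed
    then show ?thesis
      using len le desc_eq by (simp add: a_def)
  qed
  then show ?thesis
    using len by (intro nth_equalityI) auto
qed

lemma inj_on_KW_P: "inj_on KW_P {\<pi> \<in> Sym n. \<pi> \<noteq> [] \<and> hd \<pi> = 1}"
proof (rule inj_onI)
  fix \<pi> \<sigma> assume *: "\<pi> \<in> {\<pi> \<in> Sym n. \<pi> \<noteq> [] \<and> hd \<pi> = 1}" "\<sigma> \<in> {\<pi> \<in> Sym n. \<pi> \<noteq> [] \<and> hd \<pi> = 1}"
    "KW_P \<pi> = KW_P \<sigma>"
  \<comment> \<open>Nothing stands before the value \<open>1\<close>, so the code begins with the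
    \<open>0\<close> that \<open>blocks_inj\<close> requires.\<close>
  have zero: "inv_code \<tau> ! 0 = 0" if "\<tau> \<in> {\<pi> \<in> Sym n. \<pi> \<noteq> [] \<and> hd \<pi> = 1}" for \<tau>
    using that by (cases \<tau>) (auto simp: nth_inv_code)
  have "inv_code \<pi> = inv_code \<sigma>"
  proof (rule blocks_inj)
    show "length (inv_code \<pi>) = n" "length (inv_code \<sigma>) = n"
      using * by (auto simp: Sym_def)
    show "inv_code \<pi> ! 0 = 0" "inv_code \<sigma> ! 0 = 0"
      using zero * by auto
    show "inv_code \<pi> ! i \<le> n - 1 - i" "inv_code \<sigma> ! i \<le> n - 1 - i" if "i < n" for i
      using inv_code_le that * by auto
    show "blocks [] (inv_code \<pi>) = blocks [] (inv_code \<sigma>)"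
      using * KW_P_eq_blocks by (metis (no_types, lifting) mem_Collect_eq)
  qed
  then show "\<pi> = \<sigma>"
    using * inj_onD[OF inj_on_inv_code] by blast
qed

section \<open>The operators\<close>

lemma Sym_fshift: "\<pi> \<in> Sym n \<Longrightarrow> fshift \<pi> \<in> Sym (Suc n)"
  by (auto simp: Sym_def fshift_def distinct_map image_Suc_atLeastAtMost)

lemma inv_code_fshift: "\<pi> \<in> Sym n \<Longrightarrow> inv_code (fshift \<pi>) = 0 # inv_code \<pi>"
  by (rule nth_equalityI)
    (auto simp: fshift_def nth_inv_code nth_Cons larger_before_map split: nat.split)

lemma evil_fshift: "\<pi> \<in> Sym n \<Longrightarrow> evil (fshift \<pi>) \<longleftrightarrow> evil \<pi>"
  unfolding fshift_def by (subst evil_Cons_min) (auto simp: Sym_def evil_map)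

lemma KW_P_fshift: "\<pi> \<in> Sym n \<Longrightarrow> KW_P (fshift \<pi>) = blocks [0] (inv_code \<pi>)"
  by (simp add: KW_P_eq_blocks[OF Sym_fshift] inv_code_fshift blocks_Cons_zero)

text \<open>Recoils correspond to partitions one by one, so the number of recoils of an operator's
  result can be read off its partition sequence.\<close>

lemma Evil_iff: "\<pi> \<in> Evil m k \<longleftrightarrow> \<pi> \<in> Sym m \<and> \<not> evil \<pi> \<and> length (KW_P (fshift \<pi>)) = k"
  by (auto simp: Evil_def evil_avoiding_iff card_recoils KW_P_fshift)

lemma fshift_in_St:
  assumes "\<pi> \<in> Evil m k"
  shows "fshift \<pi> \<in> St (Suc m) k"
proof -
  have \<pi>: "\<pi> \<in> Sym m" "\<not> evil \<pi>" "length (descents (inv_code \<pi>)) = k"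
    using assms by (auto simp: Evil_iff KW_P_fshift)
  then have "fshift \<pi> \<in> Evil (Suc m) k"
    by (simp add: Evil_def evil_avoiding_iff evil_fshift Sym_fshift card_recoils[OF Sym_fshift]
      inv_code_fshift descents_Cons_zero)
  then show ?thesis
    by (simp add: St_def fshift_def)
qed

text \<open>\<open>inv_into\<close> returns the preimage wherever one exists in the given set and is
  unique. It therefore suffices to exhibit an element of \<open>Evil m k\<close> with the prescribed
  partition sequence.\<close>

lemma inv_into_fshift_KW_P:
  assumes "\<sigma> \<in> Evil m k" "KW_P (fshift \<sigma>) = L"
  shows "\<sigma> = inv_into (Evil m k) fshift (inv_into (St (Suc m) k) KW_P L)"
proof -
  have "inj_on KW_P (St (Suc m) k)"
    by (rule inj_on_subset[OF inj_on_KW_P[of "Suc m"]]) (auto simp: St_def Evil_def)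
  then have "inv_into (St (Suc m) k) KW_P L = fshift \<sigma>"
    using fshift_in_St[OF assms(1)] assms(2) by (metis inv_into_f_f)
  moreover have "inj_on fshift (Evil m k)"
    by (auto simp: inj_on_def fshift_def map_injective)
  ultimately show ?thesis
    using assms(1) by simp
qed

text \<open>On permutations \<open>psi_p\<close> is \<open>fshift\<close> itself, so the shift is
  applied twice; the second \<open>0\<close> in the prefix duplicates every first part.\<close>

lemma psi_p_correct:
  assumes "\<pi> \<in> Evil m k"
  shows "psi_p \<pi> \<in> Evil (Suc m) k" "KW_P (fshift (psi_p \<pi>)) = Psi1 (KW_P (fshift \<pi>))"
proof -
  have \<pi>: "\<pi> \<in> Sym m" "\<not> evil \<pi>" "length (KW_P (fshift \<pi>)) = k"
    using assms by (auto simp: Evil_iff)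
  have p: "psi_p \<pi> = fshift \<pi>"
    using \<pi>(1) by (auto simp: psi_p_def rho_def fshift_def Sym_def)
  show *: "KW_P (fshift (psi_p \<pi>)) = Psi1 (KW_P (fshift \<pi>))"
    using \<pi>(1) blocks_shift[of "[0, 0]" "[0]" 1]
    by (simp add: p KW_P_fshift KW_P_fshift[OF Sym_fshift] inv_code_fshift blocks_Cons_zero Psi1_def)
  show "psi_p \<pi> \<in> Evil (Suc m) k"
    using \<pi> * by (simp add: Evil_iff Psi1_def) (simp add: p evil_fshift Sym_fshift)
qed

section \<open>The first partition, and the operator \<open>psi_ikn\<close>\<close>

lemma block_first:
  assumes "Suc (length xs) < n"
  shows "block n (0 # xs @ ys) 0 (Suc (length xs)) =
    (n - Suc (length xs)) # drop_trailing_zeros (map (\<lambda>x. n - Suc (length xs) - x) xs)"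
proof -
  have "map (\<lambda>j. (n - Suc (length xs)) - (if j < 0 then 0 else (0 # xs @ ys) ! j)) [1..<Suc (length xs)] =
      map (\<lambda>x. n - Suc (length xs) - x) xs"
    by (rule nth_equalityI) (auto simp: nth_append simp del: upt_Suc)
  moreover have "block n (0 # xs @ ys) 0 (Suc (length xs)) = (n - Suc (length xs)) # drop_trailing_zeros
      (map (\<lambda>j. (n - Suc (length xs)) - (if j < 0 then 0 else (0 # xs @ ys) ! j)) [1..<Suc (length xs)])"
    by (rule block_Cons) (use assms in auto)
  ultimately show ?thesis
    by (simp only:)
qed

lemma hd_inv_code_less:
  assumes "\<pi> \<in> Sym m" "1 \<le> m"
  shows "hd (inv_code \<pi>) < m"
proof -
  have "inv_code \<pi> \<noteq> []"
    using assms by (auto simp: Sym_def simp flip: length_greater_0_conv)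
  then show ?thesis
    using inv_code_le[OF assms(1), of 0] assms(2) by (simp add: hd_conv_nth)
qed

text \<open>The values up to \<open>s\<close> stand in increasing order behind all
  \<open>i - 1\<close> larger ones, so each has code entry \<open>i - 1\<close>; the larger values
  keep the code of \<open>\<pi>\<close>.\<close>

lemma psi_ikn_correct:
  assumes "\<pi> \<in> Evil (i - 1) (k - 1)" "1 \<le> k" "2 \<le> i" "i + 1 \<le> n"
  shows "psi_ikn i k n \<pi> \<in> Evil (n - 1) k"
    "KW_P (fshift (psi_ikn i k n \<pi>)) = Phi i k n (KW_P (fshift \<pi>))"
proof -
  define s \<sigma> where "s = n - i" and "\<sigma> = psi_ikn i k n \<pi>"
  have s: "1 \<le> s" "n = i + s"
    using assms by (auto simp: s_def)
  have \<pi>: "\<pi> \<in> Sym (i - 1)" "\<not> evil \<pi>" "length (KW_P (fshift \<pi>)) = k - 1"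
    using assms by (auto simp: Evil_iff)
  have len: "length \<pi> = i - 1"
    using \<pi> by (simp add: Sym_def)
  have \<sigma>: "\<sigma> = map (\<lambda>x. x + s) \<pi> @ [1..<Suc s]"
    by (simp add: \<sigma>_def psi_ikn_def s_def)
  have "(\<lambda>x. x + s) ` {1..i - 1} = {s + 1..n - 1}"
    using s assms by (simp add: image_add_atLeastAtMost' add.commute)
  then have set\<sigma>: "set \<sigma> = {s + 1..n - 1} \<union> {1..s}"
    using \<pi> unfolding \<sigma> by (auto simp: Sym_def)
  have Sym: "\<sigma> \<in> Sym (n - 1)"
  proof -
    have "set \<sigma> = {1..n - 1}"
      unfolding set\<sigma> using s assms by auto
    moreover have "distinct \<sigma>"
      using \<pi> unfolding \<sigma> by (auto simp: Sym_def distinct_map inj_on_def)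
    ultimately show ?thesis
      using len s assms by (simp add: Sym_def \<sigma>)
  qed
  have code: "inv_code \<sigma> = replicate s (i - 1) @ inv_code \<pi>"
  proof (rule nth_equalityI)
    show "length (inv_code \<sigma>) = length (replicate s (i - 1) @ inv_code \<pi>)"
      by (simp add: \<sigma>)
    fix r assume "r < length (inv_code \<sigma>)"
    then have r: "r < length \<sigma>" "r < i - 1 + s"
      using len by (simp_all add: \<sigma> del: upt_Suc)
    show "inv_code \<sigma> ! r = (replicate s (i - 1) @ inv_code \<pi>) ! r"
    proof (cases "r < s")
      case True
      have "filter (\<lambda>w. Suc r < w) (map (\<lambda>x. x + s) \<pi>) = map (\<lambda>x. x + s) \<pi>"
        using \<pi>(1) True by (auto simp: filter_id_conv Sym_def)
      moreover have "Suc r \<notin> set (map (\<lambda>x. x + s) \<pi>)"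
        using \<pi>(1) True by (auto simp: Sym_def)
      ultimately show ?thesis
        using True r(1) len unfolding nth_inv_code[OF r(1)] unfolding \<sigma> larger_before_append
        by (simp add: larger_before_upt nth_append del: upt_Suc)
    next
      case False
      then obtain u where u: "r = u + s"
        by (metis le_add_diff_inverse2 not_less)
      have "Suc u \<in> set \<pi>"
        using \<pi>(1) r u by (auto simp: Sym_def)
      then have "Suc r \<in> set (map (\<lambda>x. x + s) \<pi>)"
        using u by force
      then show ?thesis
        using False r u len larger_before_map[of "\<lambda>x. x + s" "Suc u" \<pi>]
        unfolding nth_inv_code[OF r(1)] unfolding \<sigma> larger_before_append
        by (simp add: nth_append nth_inv_code)
    qed
  qed
  \<comment> \<open>This makes the end of the run of entries \<open>i - 1\<close> a descent;
    \<open>2 \<le> i\<close> guarantees an entry after it.\<close>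
  have hd: "hd (inv_code \<pi>) < i - 1"
    using hd_inv_code_less[OF \<pi>(1)] assms by simp
  have "KW_P (fshift \<sigma>) = blocks [] ((0 # replicate s (i - 1)) @ inv_code \<pi>)"
    by (simp add: KW_P_fshift[OF Sym] code blocks_Cons_zero)
  also have "\<dots> = block n (0 # replicate s (i - 1) @ inv_code \<pi>) 0 (Suc s) # blocks (0 # replicate s (i - 1)) (inv_code \<pi>)"
  proof -
    have "inv_code \<pi> \<noteq> []"
      using len assms by (simp flip: length_greater_0_conv)
    moreover have "last (0 # replicate s (i - 1)) = i - 1"
      using s by (simp add: last_replicate)
    ultimately show ?thesis
      using hd len s assms by (subst blocks_descent) (simp_all add: add.commute)
  qed
  \<comment> \<open>Here \<open>n - Suc s = i - 1\<close>, so every entry after the first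
    vanishes.\<close>
  also have "block n (0 # replicate s (i - 1) @ inv_code \<pi>) 0 (Suc s) = [i - 1]"
    using block_first[of "replicate s (i - 1)" n "inv_code \<pi>"] s assms by simp
  also have "blocks (0 # replicate s (i - 1)) (inv_code \<pi>) =
      map (\<lambda>l. replicate s (hd l) @ l) (blocks [0] (inv_code \<pi>))"
    by (rule blocks_shift) simp_all
  finally show *: "KW_P (fshift (psi_ikn i k n \<pi>)) = Phi i k n (KW_P (fshift \<pi>))"
    by (simp add: \<sigma>_def Phi_def s_def KW_P_fshift[OF \<pi>(1)])
  have "\<not> evil \<sigma>"
  proof
    assume "evil \<sigma>"
    then have "evil (map (\<lambda>x. x + s) \<pi>)"
      unfolding \<sigma> by (rule evil_skew_append_upt[rotated]) (use \<pi>(1) in \<open>auto simp: Sym_def\<close>)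
    then show False
      using \<pi>(2) evil_map[of "\<lambda>x. x + s" \<pi>] by simp
  qed
  then show "psi_ikn i k n \<pi> \<in> Evil (n - 1) k"
    using Sym * \<pi>(3) assms(2) by (simp add: Evil_iff \<sigma>_def Phi_def)
qed

section \<open>Codes of sandwiched permutations\<close>

lemma Min_recoils:
  assumes "\<pi> \<in> Sym m" "recoils \<pi> \<noteq> {}"
  shows "Min (recoils \<pi>) = hd (descents (inv_code \<pi>))"
proof -
  have "sorted (descents (inv_code \<pi>))"
    unfolding descents_def by (intro sorted_wrt_filter sorted_upt)
  moreover have "descents (inv_code \<pi>) \<noteq> []"
    using assms by (auto simp: recoils_eq_descents)
  ultimately show ?thesis
    unfolding recoils_eq_descents[OF assms(1)]
    by (cases "descents (inv_code \<pi>)") (auto intro!: Min_eqI)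
qed

text \<open>The values up to \<open>a\<close> see nothing larger before them, the final run stands
  behind all of \<open>X\<close>, and for the values in \<open>X\<close> only \<open>X\<close>
  itself matters.\<close>

lemma inv_code_sandwich:
  assumes "set X = {Suc (a + b)..m}" "length X = m - (a + b)"
  shows "inv_code ([1..<Suc a] @ X @ [Suc a..<Suc (a + b)]) =
    replicate a 0 @ replicate b (length X) @ map (\<lambda>v. larger_before v X) [Suc (a + b)..<Suc (a + b + length X)]"
    (is "inv_code ?\<pi> = ?c")
proof (rule nth_equalityI)
  show "length (inv_code ?\<pi>) = length ?c"
    by (simp del: upt_Suc)
  fix r assume "r < length (inv_code ?\<pi>)"
  then have r: "r < length ?\<pi>" "r < a + b + length X"
    by (simp_all del: upt_Suc)
  consider "r < a" | "a \<le> r" "r < a + b" | "a + b \<le> r"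
    by linarith
  then show "inv_code ?\<pi> ! r = ?c ! r"
  proof cases
    case 1
    then show ?thesis
      unfolding nth_inv_code[OF r(1)] larger_before_append
      by (simp add: nth_append larger_before_upt del: upt_Suc)
  next
    case 2
    have "filter (\<lambda>w. Suc r < w) [1..<Suc a] = []"
      using 2 by (auto simp: filter_empty_conv)
    moreover have "filter (\<lambda>w. Suc r < w) X = X"
      using 2 assms by (auto simp: filter_id_conv)
    moreover have "Suc r \<notin> set X" "Suc r \<notin> set [1..<Suc a]" "r - a < b"
      using 2 assms by auto
    ultimately show ?thesis
      using 2 unfolding nth_inv_code[OF r(1)] larger_before_append
      by (simp add: nth_append larger_before_upt del: upt_Suc)
  next
    case 3
    have "filter (\<lambda>w. Suc r < w) [1..<Suc a] = []"
      using 3 by (auto simp: filter_empty_conv)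
    moreover have "Suc r \<in> set X" "Suc r \<notin> set [1..<Suc a]"
      using 3 assms r by auto
    moreover have "[Suc (a + b)..<Suc (a + b + length X)] ! (r - (a + b)) = Suc r" "\<not> r - a < b" "\<not> r < a"
      using 3 r(2) by (auto simp: nth_upt simp del: upt_Suc)
    ultimately show ?thesis
      using 3 r(2) unfolding nth_inv_code[OF r(1)] larger_before_append
      by (simp add: nth_append del: upt_Suc)
  qed
qed

text \<open>Isolates the middle part \<open>X\<close> of large values and ties the pair
  \<open>(a, b)\<close> to the smallest recoil used in \<open>psi_q\<close>.\<close>

lemma sandwichedE:
  assumes "sandwiched a b \<pi>" "\<pi> \<in> Sym m" "recoils \<pi> \<noteq> {}"
  obtains X where "\<pi> = [1..<Suc a] @ X @ [Suc a..<Suc (a + b)]"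
    "distinct X" "set X = {Suc (a + b)..m}" "length X = m - (a + b)" "1 \<le> b" "a + b < m"
    "Min (recoils \<pi>) = a + b"
proof -
  have ab: "1 \<le> b" "a + b \<le> length \<pi>" "take a \<pi> = [1..<Suc a]"
    "drop (length \<pi> - b) \<pi> = [Suc a..<Suc (a + b)]"
    using assms(1) by (auto simp: sandwiched_def)
  have len: "length \<pi> = m" and set: "set \<pi> = {1..m}" and dist: "distinct \<pi>"
    using assms(2) by (auto simp: Sym_def)
  define X where "X = drop a (take (length \<pi> - b) \<pi>)"
  have "take (length \<pi> - b) \<pi> = take a \<pi> @ X"
  proof -
    have "take a \<pi> = take a (take (length \<pi> - b) \<pi>)"
      using ab by (simp add: min_def)
    then show ?thesis
      unfolding X_def by (metis append_take_drop_id)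
  qed
  then have \<pi>: "\<pi> = [1..<Suc a] @ X @ [Suc a..<Suc (a + b)]"
    using append_take_drop_id[of "length \<pi> - b" \<pi>] ab by simp
  have X: "distinct X" "set X \<inter> {1..<Suc a} = {}" "set X \<inter> {Suc a..<Suc (a + b)} = {}"
    using dist unfolding \<pi> by (auto simp del: upt_Suc)
  have "set \<pi> = {1..<Suc a} \<union> set X \<union> {Suc a..<Suc (a + b)}"
    by (subst \<pi>) (simp del: upt_Suc add: Un_assoc)
  then have "set X = {1..m} - ({1..<Suc a} \<union> {Suc a..<Suc (a + b)})"
    using X set by auto
  moreover have "{1..m} - ({1..<Suc a} \<union> {Suc a..<Suc (a + b)}) = {Suc (a + b)..m}"
    by auto
  ultimately have setX: "set X = {Suc (a + b)..m}"
    by (rule trans)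
  have lenX: "length X = m - (a + b)"
    using distinct_card[OF X(1)] setX by simp
  define c2 where "c2 = map (\<lambda>v. larger_before v X) [Suc (a + b)..<Suc (a + b + length X)]"
  have code: "inv_code \<pi> = (replicate a 0 @ replicate b (length X)) @ c2"
    unfolding c2_def using inv_code_sandwich[OF setX lenX] by (subst \<pi>) simp
  have ne: "descents (inv_code \<pi>) \<noteq> []"
    using assms(2,3) by (auto simp: recoils_eq_descents)
  have sorted: "sorted (replicate a 0 @ replicate b (length X))"
    by (auto simp: sorted_append)
  \<comment> \<open>With an empty middle part the code would be sorted, leaving no recoil.\<close>
  have lt: "a + b < m"
  proof (rule ccontr)
    assume "\<not> a + b < m"
    then have "c2 = []"
      using lenX by (simp add: c2_def)
    then show False
      using ne sorted by (simp add: code descents_sorted)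
  qed
  have "Min (recoils \<pi>) = a + b"
  proof -
    have c2: "c2 \<noteq> []" "hd c2 = larger_before (Suc (a + b)) X"
      using lt lenX by (simp_all add: c2_def hd_map upt_conv_Cons del: upt_Suc)
    \<comment> \<open>The value \<open>Suc (a + b)\<close> lies in \<open>X\<close>, so fewer than
      \<open>length X\<close> larger values precede it, against exactly \<open>length X\<close> for
      \<open>a + b\<close>: a descent at \<open>a + b\<close>.\<close>
    have "Suc (a + b) \<in> set X"
      using setX lt by simp
    then have "hd c2 < length X"
      using c2 larger_before_less by simp
    then have "descents (inv_code \<pi>) = [a + b] @ map (\<lambda>i. i + (a + b)) (descents c2)"
      unfolding code using ab(1) c2(1) sorted
      by (subst descents_append) (simp_all add: descents_sorted)
    then show ?thesis
      using Min_recoils[OF assms(2,3)] by simp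
  qed
  with that \<pi> X(1) setX lenX ab(1) lt show ?thesis
    by blast
qed

text \<open>Since the code determines the permutation, it suffices to compare \<open>\<pi>\<close> with the sandwiched
  permutation that has the same large values in the same order.\<close>

lemma sandwiched_if_inv_code:
  assumes "\<pi> \<in> Sym m" "a + b < m" "1 \<le> b"
    "inv_code \<pi> = replicate a 0 @ replicate b (m - (a + b)) @ c"
  shows "sandwiched a b \<pi>"
proof -
  have len: "length \<pi> = m" and set: "set \<pi> = {1..m}" and dist: "distinct \<pi>"
    using assms(1) by (auto simp: Sym_def)
  define X where "X = filter (\<lambda>w. a + b < w) \<pi>"
  have setX: "set X = {Suc (a + b)..m}"
    using set by (auto simp: X_def)
  have distX: "distinct X"
    using dist by (simp add: X_def)
  have lenX: "length X = m - (a + b)"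
    using distinct_card[OF distX] setX by simp
  define \<pi>' where "\<pi>' = [1..<Suc a] @ X @ [Suc a..<Suc (a + b)]"
  have set': "set \<pi>' = {1..m}"
    using assms(2) unfolding \<pi>'_def by (auto simp: setX simp del: upt_Suc)
  have "distinct \<pi>'"
    using distX unfolding \<pi>'_def by (auto simp: setX simp del: upt_Suc)
  moreover have "length \<pi>' = m"
    using lenX assms(2) unfolding \<pi>'_def by (simp del: upt_Suc)
  ultimately have Sym': "\<pi>' \<in> Sym m"
    using set' by (simp add: Sym_def)
  have "inv_code \<pi>' = inv_code \<pi>"
  proof (rule nth_equalityI)
    show "length (inv_code \<pi>') = length (inv_code \<pi>)"
      using \<open>length \<pi>' = m\<close> len by simp
    fix r assume "r < length (inv_code \<pi>')"
    then have r: "r < m"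
      using \<open>length \<pi>' = m\<close> by simp
    have code': "inv_code \<pi>' = replicate a 0 @ replicate b (m - (a + b)) @
        map (\<lambda>v. larger_before v X) [Suc (a + b)..<Suc (a + b + length X)]"
      unfolding \<pi>'_def using inv_code_sandwich[OF setX lenX] lenX by simp
    show "inv_code \<pi>' ! r = inv_code \<pi> ! r"
    proof (cases "r < a + b")
      case True
      then show ?thesis
        unfolding code' assms(4) by (auto simp: nth_append)
    next
      case False
      then have "[Suc (a + b)..<Suc (a + b + length X)] ! (r - (a + b)) = Suc r" "\<not> r - a < b" "\<not> r < a"
        using r lenX by (auto simp: nth_upt simp del: upt_Suc)
      then have "inv_code \<pi>' ! r = larger_before (Suc r) X"
        unfolding code' using False r lenX by (simp add: nth_append del: upt_Suc)
      \<comment> \<open>Values up to \<open>a + b\<close> are never counted here, and filtering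
        keeps the order of the others.\<close>
      also have "\<dots> = larger_before (Suc r) \<pi>"
        unfolding X_def using False by (intro larger_before_filter) simp
      also have "\<dots> = inv_code \<pi> ! r"
        using r len by (simp add: nth_inv_code)
      finally show ?thesis .
    qed
  qed
  then have "\<pi> = \<pi>'"
    using inj_onD[OF inj_on_inv_code] assms(1) Sym' by metis
  then show ?thesis
    using assms(2,3) lenX unfolding sandwiched_def \<pi>'_def by (simp del: upt_Suc)
qed

section \<open>Evil avoidance and codes for \<open>psi_q\<close>\<close>

lemma descents_perm_inv: "set (descents (perm_inv \<pi>)) = recoils \<pi>"
  by (auto simp: descents_def recoils_def)

text \<open>No recoil lies below \<open>t\<close>, so the inverse has no descent on the values up to
  \<open>t\<close>; \<open>descents_mono\<close> is applied to the inverse itself.\<close>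

lemma small_values_increasing:
  assumes "\<pi> \<in> Sym m" "\<And>r. r \<in> recoils \<pi> \<Longrightarrow> t \<le> r" "r < s" "s < m" "\<pi> ! r \<le> t" "\<pi> ! s \<le> t"
  shows "\<pi> ! r < \<pi> ! s"
proof (rule ccontr)
  assume not: "\<not> \<pi> ! r < \<pi> ! s"
  have "\<pi> ! r \<in> set \<pi>" "length \<pi> = m"
    using assms by (auto simp: Sym_def)
  then have r: "1 \<le> \<pi> ! r" "\<pi> ! r \<le> m"
    using assms(1) by (auto simp: Sym_def)
  have "perm_inv \<pi> ! (\<pi> ! s - 1) \<le> perm_inv \<pi> ! (\<pi> ! r - 1)"
  proof (rule descents_mono)
    fix u assume "u \<le> \<pi> ! r - 1"
    then have "u < t"
      using r assms(5) by linarith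
    then show "u \<notin> set (descents (perm_inv \<pi>))"
      using assms(2)[of u] descents_perm_inv by auto
  qed (use not r \<open>length \<pi> = m\<close> in auto)
  then show False
    using perm_inv_nth[OF assms(1), of r] perm_inv_nth[OF assms(1), of s] assms(3,4) by simp
qed

text \<open>In 4132, 4213 and 3214 two letters below the first one decrease from left to right. Only
  2413 remains, with \<open>v\<close> as its 2.\<close>

lemma evil_Cons_smaller_increasing:
  assumes "evil (v # ys)" "\<not> evil ys"
    and "\<And>r s. r < s \<Longrightarrow> s < length ys \<Longrightarrow> ys ! r < v \<Longrightarrow> ys ! s < v \<Longrightarrow> ys ! r < ys ! s"
  obtains j k l where "j < k" "k < l" "l < length ys" "ys ! k < v" "v < ys ! l" "ys ! l < ys ! j"
proof -
  obtain j k l where *: "j < k" "k < l" "l < length ys" "evil4 v (ys ! j) (ys ! k) (ys ! l)"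
    using assms(1,2) unfolding evil_Cons by blast
  have "ys ! j < v \<Longrightarrow> ys ! k < v \<Longrightarrow> ys ! j < ys ! k" "ys ! k < v \<Longrightarrow> ys ! l < v \<Longrightarrow> ys ! k < ys ! l"
    using assms(3) * by auto
  then have "ys ! k < v \<and> v < ys ! l \<and> ys ! l < ys ! j"
    using *(4) unfolding evil4_def by linarith
  then show ?thesis
    using that * by blast
qed

definition raise :: "nat \<Rightarrow> nat \<Rightarrow> nat" where
  "raise v x = (if v \<le> x then x + 1 else x)"

lemma raise_less_iff: "raise v x < raise v y \<longleftrightarrow> x < y"
  by (auto simp: raise_def)

lemma rho_front: "rho v 1 \<pi> = v # map (raise v) \<pi>"
  by (simp add: rho_def raise_def)

text \<open>The values below the new first entry increase from left to right, so only 2413 could arise;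
  its last three entries together with \<open>t\<close> and \<open>Suc t\<close> would give 2413, 4213 or 4132 in \<open>\<pi>\<close>.\<close>

lemma not_evil_rho:
  assumes "\<pi> \<in> Sym m" "\<not> evil \<pi>" "t \<in> recoils \<pi>" "\<And>r. r \<in> recoils \<pi> \<Longrightarrow> t \<le> r"
  shows "\<not> evil (rho (Suc t) 1 \<pi>)"
proof
  let ?g = "raise (Suc t)"
  assume "evil (rho (Suc t) 1 \<pi>)"
  then have ev: "evil (Suc t # map ?g \<pi>)"
    by (simp only: rho_front)
  have len: "length \<pi> = m"
    using assms(1) by (simp add: Sym_def)
  have small: "?g x < Suc t \<longleftrightarrow> x \<le> t" "Suc t < ?g x \<longleftrightarrow> t < x" for x
    by (auto simp: raise_def)
  have incr: "\<pi> ! r < \<pi> ! s" if "r < s" "s < m" "\<pi> ! r \<le> t" "\<pi> ! s \<le> t" for r s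
    using small_values_increasing[OF assms(1,4)] that by blast
  obtain j k l where "j < k" "k < l" "l < length (map ?g \<pi>)" "map ?g \<pi> ! k < Suc t"
    "Suc t < map ?g \<pi> ! l" "map ?g \<pi> ! l < map ?g \<pi> ! j"
  proof (rule evil_Cons_smaller_increasing[OF ev])
    show "\<not> evil (map ?g \<pi>)"
      using assms(2) by (simp add: evil_map raise_less_iff)
    show "map ?g \<pi> ! r < map ?g \<pi> ! s"
      if "r < s" "s < length (map ?g \<pi>)" "map ?g \<pi> ! r < Suc t" "map ?g \<pi> ! s < Suc t" for r s
      using that incr[of r s] len by (simp add: small raise_less_iff)
  qed
  then have jkl: "j < k" "k < l" "l < m" "\<pi> ! k \<le> t" "t < \<pi> ! l" "\<pi> ! l < \<pi> ! j"
    using len by (auto simp: small raise_less_iff)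
  have t: "1 \<le> t" "t < m" "perm_inv \<pi> ! t < perm_inv \<pi> ! (t - 1)"
    using assms(3) len by (auto simp: recoils_def)
  have "t - 1 < m" "Suc (t - 1) = t"
    using t by auto
  then obtain p where p: "p < m" "\<pi> ! p = t" "perm_inv \<pi> ! (t - 1) = Suc p"
    using perm_inv_nthE[OF assms(1), of "t - 1"] by metis
  obtain p' where p': "p' < m" "\<pi> ! p' = Suc t" "perm_inv \<pi> ! t = Suc p'"
    using perm_inv_nthE[OF assms(1), of t] t by auto
  have "p' < p"
    using t p p' by simp
  \<comment> \<open>Among the values up to \<open>t\<close>, which increase from left to right,
    \<open>t\<close> comes last.\<close>
  have "k \<le> p"
    using incr[of p k] jkl p by fastforce
  show False
  proof (cases "p < l")
    case True
    have "\<pi> ! l \<noteq> Suc t"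
    proof
      assume "\<pi> ! l = Suc t"
      then have "l = p'"
        using assms(1) p' jkl len by (metis (no_types, lifting) Sym_def mem_Collect_eq nth_eq_iff_index_eq)
      then show False
        using \<open>p' < p\<close> True by simp
    qed
    then have l: "Suc t < \<pi> ! l"
      using jkl by simp
    \<comment> \<open>With \<open>t\<close> as the 1: if \<open>Suc t\<close> stands left of
      \<open>j\<close>, it is the 2 of a 2413; otherwise it is the 2 of a 4213.\<close>
    consider "p' < j" | "j < p'"
      using l jkl p' by (metis nat_neq_iff order.asym)
    then have "evil \<pi>"
    proof cases
      case 1
      then show ?thesis
        unfolding evil_def using jkl p p' l \<open>k \<le> p\<close> True len
        by (intro exI[of _ p'] exI[of _ j] exI[of _ p] exI[of _ l]) (auto simp: evil4_def)
    next
      case 2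
      then show ?thesis
        unfolding evil_def using jkl p p' l \<open>p' < p\<close> True len
        by (intro exI[of _ j] exI[of _ p'] exI[of _ p] exI[of _ l]) (auto simp: evil4_def)
    qed
    then show False
      using assms(2) by simp
  next
    case False
    \<comment> \<open>Now \<open>t\<close> comes after all three entries and is the 2 of a
      4132.\<close>
    then have "l < p"
      using p jkl by (metis nat_neq_iff)
    then have "\<pi> ! k < t"
      using incr[of k p] jkl p by simp
    then have "evil \<pi>"
      unfolding evil_def using jkl p \<open>l < p\<close> len
      by (intro exI[of _ j] exI[of _ k] exI[of _ l] exI[of _ p]) (auto simp: evil4_def)
    then show False
      using assms(2) by simp
  qed
qed

lemma Sym_rho:
  assumes "\<pi> \<in> Sym m" "t \<le> m"
  shows "rho (Suc t) 1 \<pi> \<in> Sym (Suc m)"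
proof -
  have "inj (raise (Suc t))"
    by (rule injI) (auto simp: raise_def split: if_splits)
  moreover have "raise (Suc t) ` {1..m} = {1..t} \<union> {Suc (Suc t)..Suc m}"
  proof -
    have "raise (Suc t) ` {1..t} = {1..t}"
      by (auto simp: raise_def image_iff)
    moreover have "raise (Suc t) ` {Suc t..m} = Suc ` {Suc t..m}"
      by (auto simp: raise_def image_iff)
    moreover have "{1..m} = {1..t} \<union> {Suc t..m}"
      using assms(2) by auto
    ultimately show ?thesis
      by (simp add: image_Un image_Suc_atLeastAtMost)
  qed
  ultimately show ?thesis
    using assms unfolding rho_front
    by (auto simp: Sym_def distinct_map intro: inj_on_subset[OF _ subset_UNIV])
qed

text \<open>The new front entry precedes everything and exceeds exactly the values up to
  \<open>t\<close>, which adds one to their code entries; the values above it are only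
  relabelled.\<close>

lemma inv_code_rho:
  assumes "\<pi> \<in> Sym m" "t \<le> m"
  shows "inv_code (rho (Suc t) 1 \<pi>) = map Suc (take t (inv_code \<pi>)) @ 0 # drop t (inv_code \<pi>)"
    (is "?l = ?r")
proof (rule nth_equalityI)
  have len: "length \<pi> = m"
    using assms(1) by (simp add: Sym_def)
  show "length ?l = length ?r"
    using len assms(2) by (simp add: rho_front del: One_nat_def)
  fix i assume "i < length ?l"
  then have i: "i < Suc m"
    using len by (simp add: rho_front del: One_nat_def)
  then have l: "?l ! i = larger_before (Suc i) (Suc t # map (raise (Suc t)) \<pi>)"
    using len by (simp add: rho_front nth_inv_code del: One_nat_def)
  consider "i < t" | "i = t" | "t < i"
    by linarith
  then show "?l ! i = ?r ! i"
  proof cases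
    case 1
    then show ?thesis
      unfolding l using larger_before_map[OF raise_less_iff, of "Suc t" "Suc i" \<pi>] assms(2) len
      by (simp add: raise_def[of _ "Suc i"] nth_append nth_inv_code)
  next
    case 2
    then show ?thesis
      unfolding l using assms(2) len by (simp add: nth_append)
  next
    case 3
    then show ?thesis
      unfolding l using larger_before_map[OF raise_less_iff, of "Suc t" i \<pi>] assms(2) len i
      by (simp add: raise_def[of _ i] nth_append nth_inv_code nth_Cons')
  qed
qed

text \<open>Behind the new head stand the smallest values in order, followed by a shifted copy of a
  subsequence of the old word. The entries below the head increase, so it could only start a 2413.
  Its 4 and 3 would lie in \<open>map Suc X\<close> with the 1 between them, but that stretch has no
  entry below the head.\<close>

lemma not_evil_sandwich_shift:
  assumes "\<not> evil ([1..<Suc a] @ X @ [Suc a..<Suc t])" "\<And>x. x \<in> set X \<Longrightarrow> t < x" "a < t"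
  shows "\<not> evil (Suc t # [1..<Suc (Suc a)] @ map Suc X @ [Suc (Suc a)..<Suc t])"
proof
  let ?ys = "[1..<Suc (Suc a)] @ map Suc X @ [Suc (Suc a)..<Suc t]"
  assume ev: "evil (Suc t # ?ys)"
  have "subseq (X @ [Suc a..<t]) ([1..<Suc a] @ X @ [Suc a..<Suc t])"
    using assms(3) by (intro list_emb_append2[OF prefix_imp_subseq]) simp
  then have "\<not> evil (X @ [Suc a..<t])"
    using assms(1) evil_subseq by blast
  then have "\<not> evil (map Suc (X @ [Suc a..<t]))"
    by (simp add: evil_map del: map_append)
  moreover have "map Suc (X @ [Suc a..<t]) = map Suc X @ [Suc (Suc a)..<Suc t]"
    by (simp add: map_Suc_upt del: upt_Suc)
  moreover have "Suc (Suc a) \<le> y" if "y \<in> set (map Suc X @ [Suc (Suc a)..<Suc t])" for y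
    using that assms(2,3) by fastforce
  ultimately have "\<not> evil ?ys"
    using evil_upt_append by metis
  have len: "length ?ys = length X + t"
    using assms(3) by (simp del: upt_Suc)
  have left: "?ys ! r = Suc r" if "r < Suc a" for r
    using that by (simp add: nth_append del: upt_Suc)
  have mid: "Suc t < ?ys ! r" if "Suc a \<le> r" "r < Suc a + length X" for r
  proof -
    have "r - Suc a < length X"
      using that by linarith
    moreover from this have "X ! (r - Suc a) \<in> set X"
      by simp
    ultimately show ?thesis
      using that assms(2) by (simp add: nth_append del: upt_Suc nth_mem)
  qed
  have right: "?ys ! r = Suc r - length X" if "Suc a + length X \<le> r" "r < length X + t" for r
  proof -
    have "\<not> r - Suc a < length X"
      using that by linarith
    then have "?ys ! r = [Suc (Suc a)..<Suc t] ! (r - Suc a - length X)"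
      using that by (simp add: nth_append del: upt_Suc)
    also have "\<dots> = Suc r - length X"
      using that by (subst nth_upt) auto
    finally show ?thesis .
  qed
  have cases: "r < Suc a \<and> ?ys ! r = Suc r \<or>
      Suc a \<le> r \<and> r < Suc a + length X \<and> Suc t < ?ys ! r \<or>
      Suc a + length X \<le> r \<and> ?ys ! r = Suc r - length X \<and> ?ys ! r < Suc t"
    if "r < length ?ys" for r
    using left[of r] mid[of r] right[of r] that len by linarith
  obtain j k l where jkl: "j < k" "k < l" "l < length ?ys" "?ys ! k < Suc t" "Suc t < ?ys ! l"
    "?ys ! l < ?ys ! j"
  proof (rule evil_Cons_smaller_increasing[OF ev \<open>\<not> evil ?ys\<close>])
    fix r s assume "r < s" "s < length ?ys" "?ys ! r < Suc t" "?ys ! s < Suc t"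
    then show "?ys ! r < ?ys ! s"
      using cases[of r] cases[of s] by linarith
  qed
  then show False
    using cases[of j] cases[of k] cases[of l] assms(3) by linarith
qed

lemma gamma_append:
  "p = length xs + length ys + 1 \<Longrightarrow> q = length xs + 1 \<Longrightarrow>
    gamma p q (xs @ ys @ z # zs) = xs @ z # ys @ zs"
  by (simp add: gamma_def Let_def nth_append)

text \<open>The head is the only larger entry before the initial run; the final run also has all of
  \<open>map Suc X\<close> before it.\<close>

lemma inv_code_sandwich_shift:
  assumes "set X = {Suc t..m}" "length X = m - t" "a < t" "t < m"
  shows "inv_code (Suc t # [1..<Suc (Suc a)] @ map Suc X @ [Suc (Suc a)..<Suc t]) =
    (replicate (Suc a) 1 @ replicate (t - Suc a) (Suc (length X))) @
      0 # map (\<lambda>v. larger_before v X) [Suc t..<Suc (t + length X)]"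
    (is "inv_code (Suc t # ?\<tau>) = ?c")
proof -
  let ?Y = "map Suc X"
  have setY: "set ?Y = {Suc (Suc t)..Suc m}"
    using assms(1) by (simp add: image_Suc_atLeastAtMost)
  show ?thesis
  proof (rule nth_equalityI)
    show "length (inv_code (Suc t # ?\<tau>)) = length ?c"
      using assms(3) by (simp del: upt_Suc)
    fix r assume "r < length (inv_code (Suc t # ?\<tau>))"
    then have r: "r < length (Suc t # ?\<tau>)" "r < Suc m"
      using assms by (simp_all del: upt_Suc)
    consider "r \<le> a" | "a < r" "r < t" | "r = t" | "t < r"
      by linarith
    then show "inv_code (Suc t # ?\<tau>) ! r = ?c ! r"
    proof cases
      case 1
      then have "larger_before (Suc r) ?\<tau> = 0"
        unfolding larger_before_append by (simp add: larger_before_upt del: upt_Suc)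
      then show ?thesis
        unfolding nth_inv_code[OF r(1)] using 1 assms(3)
        by (simp add: nth_append nth_Cons' del: upt_Suc replicate_Suc)
    next
      case 2
      have "filter (\<lambda>w. Suc r < w) [1..<Suc (Suc a)] = []"
        using 2 by (auto simp: filter_empty_conv)
      moreover have "filter (\<lambda>w. Suc r < w) ?Y = ?Y"
        using 2 setY by (auto simp: filter_id_conv)
      moreover have "Suc r \<notin> set ?Y" "Suc r \<notin> set [1..<Suc (Suc a)]"
        using 2 setY by auto
      ultimately have "larger_before (Suc r) ?\<tau> = length X"
        using 2 unfolding larger_before_append by (simp add: larger_before_upt del: upt_Suc)
      then show ?thesis
        unfolding nth_inv_code[OF r(1)] using 2
        by (simp add: nth_append del: upt_Suc replicate_Suc)
    next
      case 3
      then show ?thesis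
        unfolding nth_inv_code[OF r(1)] using assms(3) by (simp add: nth_append del: upt_Suc replicate_Suc)
    next
      case 4
      have "filter (\<lambda>w. Suc r < w) [1..<Suc (Suc a)] = []"
        using 4 assms(3) by (auto simp: filter_empty_conv)
      moreover have "Suc r \<in> set ?Y" "Suc r \<notin> set [1..<Suc (Suc a)]"
        using 4 setY r(2) assms(3) by auto
      ultimately have "larger_before (Suc r) ?\<tau> = larger_before (Suc r) ?Y"
        unfolding larger_before_append by (simp del: upt_Suc)
      also have "\<dots> = larger_before r X"
        by (rule larger_before_map) simp
      finally have *: "larger_before (Suc r) ?\<tau> = larger_before r X" .
      have "?c ! r = map (\<lambda>v. larger_before v X) [Suc t..<Suc (t + length X)] ! (r - Suc t)"
        using 4 assms(3) by (simp add: nth_append nth_Cons' del: upt_Suc replicate_Suc)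
      also have "\<dots> = larger_before r X"
        using 4 r(2) assms(2,4) by (subst nth_map) (auto simp: nth_upt simp del: upt_Suc)
      finally show ?thesis
        unfolding nth_inv_code[OF r(1)] using 4 * by (simp del: upt_Suc)
    qed
  qed
qed

text \<open>Separates the first partition, which \<open>Psi2\<close> treats specially, from the
  others. The leading \<open>0\<close> of the shift raises the size and the descent by one, so the
  first part is \<open>m - length c1\<close>.\<close>

lemma KW_P_fshift_first_run:
  assumes "\<pi> \<in> Sym m" "inv_code \<pi> = c1 @ c2" "sorted c1" "c1 \<noteq> []" "c2 \<noteq> []" "hd c2 < last c1"
  shows "KW_P (fshift \<pi>) = ((m - length c1) # drop_trailing_zeros (map (\<lambda>x. m - length c1 - x) c1)) #
    blocks (0 # c1) c2"
proof -
  have "length (inv_code \<pi>) = m"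
    using assms(1) by (simp add: Sym_def)
  then have m: "m = length c1 + length c2"
    using assms(2) by simp
  have "KW_P (fshift \<pi>) = blocks [] ((0 # c1) @ c2)"
    by (simp add: KW_P_fshift[OF assms(1)] assms(2) blocks_Cons_zero)
  also have "\<dots> = block (Suc m) (0 # c1 @ c2) 0 (Suc (length c1)) # blocks (0 # c1) c2"
    using assms m by (subst blocks_descent) simp_all
  also have "block (Suc m) (0 # c1 @ c2) 0 (Suc (length c1)) =
      (m - length c1) # drop_trailing_zeros (map (\<lambda>x. m - length c1 - x) c1)"
    using block_first[of c1 "Suc m" c2] m assms(5) by simp
  finally show ?thesis .
qed

lemma psi_q_correct:
  assumes "\<pi> \<in> Evil m k" "1 \<le> k"
  shows "psi_q \<pi> \<in> Evil (Suc m) k" "KW_P (fshift (psi_q \<pi>)) = Psi2 (KW_P (fshift \<pi>))"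
proof -
  define t where "t = Min (recoils \<pi>)"
  define c1 c2 where "c1 = take t (inv_code \<pi>)" and "c2 = drop t (inv_code \<pi>)"
  have \<pi>: "\<pi> \<in> Sym m" "\<not> evil \<pi>" "length (KW_P (fshift \<pi>)) = k"
    using assms(1) by (auto simp: Evil_iff)
  have len: "length \<pi> = m"
    using \<pi>(1) by (simp add: Sym_def)
  have fin: "finite (recoils \<pi>)"
    by (simp add: recoils_eq_descents[OF \<pi>(1)])
  have ne: "recoils \<pi> \<noteq> {}"
    using assms by (auto simp: Evil_def)
  have t_in: "t \<in> recoils \<pi>" and t_le: "\<And>r. r \<in> recoils \<pi> \<Longrightarrow> t \<le> r"
    using fin ne by (auto simp: t_def)
  have t_desc: "1 \<le> t" "t < m" "inv_code \<pi> ! t < inv_code \<pi> ! (t - 1)"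
    using t_in len unfolding recoils_eq_descents[OF \<pi>(1)] set_descents by auto
  have code: "inv_code \<pi> = c1 @ c2"
    by (simp add: c1_def c2_def)
  have c1: "length c1 = t" "c1 \<noteq> []" "c2 \<noteq> []" "hd c2 < last c1"
  proof -
    show "length c1 = t"
      using t_desc len by (simp add: c1_def)
    then show "c1 \<noteq> []"
      using t_desc by auto
    then have "last c1 = inv_code \<pi> ! (t - 1)"
      using \<open>length c1 = t\<close> t_desc by (simp add: last_conv_nth c1_def)
    then show "hd c2 < last c1"
      using t_desc len by (simp add: c2_def hd_drop_conv_nth)
    show "c2 \<noteq> []"
      using t_desc len by (simp add: c2_def)
  qed
  have "sorted c1"
    unfolding sorted_iff_nth_mono
  proof (intro allI impI)
    fix i j assume "i \<le> j" "j < length c1"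
    moreover from this have "inv_code \<pi> ! i \<le> inv_code \<pi> ! j"
      using t_desc len c1(1) t_le recoils_eq_descents[OF \<pi>(1)]
      by (intro descents_mono) (fastforce dest: t_le)+
    ultimately show "c1 ! i \<le> c1 ! j"
      by (simp add: c1_def)
  qed
  have old: "KW_P (fshift \<pi>) = ((m - t) # drop_trailing_zeros (map (\<lambda>x. m - t - x) c1)) # blocks (0 # c1) c2"
    using KW_P_fshift_first_run[OF \<pi>(1) code \<open>sorted c1\<close> c1(2-4)] c1(1) by simp
  \<comment> \<open>Both cases of \<open>psi_q\<close> produce a code of this shape. As
    \<open>e\<close> is positive, the inserted \<open>0\<close> puts a descent at \<open>t\<close>;
    it then joins the prefix, whose extra entry duplicates the first parts of the later
    partitions.\<close>
  have new: "KW_P (fshift \<sigma>) = ((Suc m - t) # drop_trailing_zeros (map (\<lambda>x. Suc m - t - x) e)) #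
      map (\<lambda>l. hd l # l) (blocks (0 # c1) c2)"
    if "\<sigma> \<in> Sym (Suc m)" "inv_code \<sigma> = e @ 0 # c2" "sorted e" "length e = t" "\<forall>x \<in> set e. 0 < x" for \<sigma> e
  proof -
    have "e \<noteq> []"
      using that(4) t_desc by auto
    then have "KW_P (fshift \<sigma>) = ((Suc m - t) # drop_trailing_zeros (map (\<lambda>x. Suc m - t - x) e)) #
        blocks (0 # e) (0 # c2)"
      using KW_P_fshift_first_run[OF that(1-3)] that(4,5) by simp
    also have "blocks (0 # e) (0 # c2) = map (\<lambda>l. replicate 1 (hd l) @ l) (blocks (0 # c1) c2)"
      unfolding blocks_Cons_zero using that(4) c1(1) by (intro blocks_shift) simp_all
    finally show ?thesis
      by simp
  qed
  have "psi_q \<pi> \<in> Sym (Suc m) \<and> \<not> evil (psi_q \<pi>) \<and> KW_P (fshift (psi_q \<pi>)) = Psi2 (KW_P (fshift \<pi>))"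
  proof (cases "\<exists>a b. sandwiched a b \<pi>")
    case True
    \<comment> \<open>About the chosen pair only \<open>sandwiched a b \<pi>\<close> may be
      used.\<close>
    obtain a b where ab: "(SOME ab. sandwiched (fst ab) (snd ab) \<pi>) = (a, b)"
      by (metis surj_pair)
    have "sandwiched (fst (SOME ab. sandwiched (fst ab) (snd ab) \<pi>)) (snd (SOME ab. sandwiched (fst ab) (snd ab) \<pi>)) \<pi>"
      using True by (intro someI_ex[of "\<lambda>ab. sandwiched (fst ab) (snd ab) \<pi>"]) auto
    then have "sandwiched a b \<pi>"
      by (simp add: ab)
    then obtain X where X: "\<pi> = [1..<Suc a] @ X @ [Suc a..<Suc (a + b)]"
      "distinct X" "set X = {Suc (a + b)..m}" "length X = m - (a + b)" "1 \<le> b" "a + b < m"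
      "Min (recoils \<pi>) = a + b"
      using sandwichedE[OF _ \<pi>(1) ne] by metis
    then have t: "t = a + b" "a < t"
      by (simp_all add: t_def)
    define \<sigma> where "\<sigma> = Suc t # [1..<Suc (Suc a)] @ map Suc X @ [Suc (Suc a)..<Suc t]"
    have "psi_q \<pi> = gamma (m - b + 2) (a + 2) (rho (Suc t) 1 \<pi>)"
      unfolding psi_q_def using True by (simp add: ab len t_def)
    also have "rho (Suc t) 1 \<pi> = (Suc t # [1..<Suc a]) @ map Suc X @ Suc a # [Suc (Suc a)..<Suc t]"
    proof -
      have "map (raise (Suc t)) [1..<Suc a] = [1..<Suc a]"
        using t by (intro map_idI) (auto simp: raise_def)
      moreover have "map (raise (Suc t)) X = map Suc X"
        using X(3) t by (intro map_cong) (auto simp: raise_def)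
      moreover have "map (raise (Suc t)) [Suc a..<Suc t] = [Suc a..<Suc t]"
        using t by (intro map_idI) (auto simp: raise_def)
      moreover have "[Suc a..<Suc t] = Suc a # [Suc (Suc a)..<Suc t]"
        using t by (simp add: upt_conv_Cons)
      moreover have "\<pi> = [1..<Suc a] @ X @ [Suc a..<Suc t]"
        using X(1) t by simp
      ultimately show ?thesis
        unfolding rho_front by (metis append_Cons map_append)
    qed
    \<comment> \<open>The moved entry is \<open>Suc a\<close>, the first of the final run; the new
      head accounts for one unit of each offset.\<close>
    also have "gamma (m - b + 2) (a + 2) \<dots> = (Suc t # [1..<Suc a]) @ Suc a # map Suc X @ [Suc (Suc a)..<Suc t]"
      using X(4-6) by (intro gamma_append) (simp_all del: upt_Suc)
    also have "\<dots> = \<sigma>"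
      by (simp add: \<sigma>_def)
    finally have psi: "psi_q \<pi> = \<sigma>" .
    have "\<not> evil \<sigma>"
      unfolding \<sigma>_def using \<pi>(2) X(1,3) t by (intro not_evil_sandwich_shift) auto
    have Sym: "\<sigma> \<in> Sym (Suc m)"
    proof -
      have "set \<sigma> = {1..Suc m}"
        using X(3,6) t by (auto simp: \<sigma>_def image_Suc_atLeastAtMost simp del: upt_Suc)
      moreover have "length \<sigma> = Suc m"
        using X(4,6) t by (simp add: \<sigma>_def del: upt_Suc)
      ultimately show ?thesis
        by (simp add: Sym_def card_distinct)
    qed
    define e where "e = replicate (Suc a) 1 @ replicate (b - 1) (Suc (m - t))"
    have "inv_code \<pi> = (replicate a 0 @ replicate b (m - t)) @
        map (\<lambda>v. larger_before v X) [Suc t..<Suc (t + length X)]"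
      using inv_code_sandwich[OF X(3,4)] X(1,4) t by simp
    then have c12: "c1 = replicate a 0 @ replicate b (m - t)"
        "c2 = map (\<lambda>v. larger_before v X) [Suc t..<Suc (t + length X)]"
      using t by (simp_all add: c1_def c2_def del: upt_Suc)
    have "inv_code \<sigma> = e @ 0 # c2"
      using inv_code_sandwich_shift[of X t m a] X t unfolding \<sigma>_def e_def c12 by simp
    then have "KW_P (fshift \<sigma>) = ((Suc m - t) # drop_trailing_zeros (map (\<lambda>x. Suc m - t - x) e)) #
      map (\<lambda>l. hd l # l) (blocks (0 # c1) c2)"
      using X(5) t by (intro new[OF Sym]) (auto simp: e_def sorted_append)
    moreover have "drop_trailing_zeros (map (\<lambda>x. Suc m - t - x) e) = replicate (Suc a) (m - t)"
    proof -
      have "map (\<lambda>x. Suc m - t - x) e = replicate (Suc a) (m - t) @ replicate (b - 1) 0"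
        using t_desc by (simp add: e_def Suc_diff_le)
      then show ?thesis
        using t_desc by (simp add: drop_trailing_zeros_replicate del: replicate_Suc)
    qed
    moreover have "drop_trailing_zeros (map (\<lambda>x. m - t - x) c1) = replicate a (m - t)"
      using t_desc by (simp add: c12 drop_trailing_zeros_replicate)
    \<comment> \<open>The old first partition is \<open>a + 1\<close> copies of
      \<open>m - t\<close>, so \<open>Psi2\<close> prepends the larger part.\<close>
    ultimately have "KW_P (fshift \<sigma>) = Psi2 (KW_P (fshift \<pi>))"
      unfolding old using t_desc by (simp add: Psi2_def Suc_diff_le del: diff_diff_left)
    then show ?thesis
      using Sym \<open>\<not> evil \<sigma>\<close> psi by simp
  next
    case False
    have psi: "psi_q \<pi> = rho (Suc t) 1 \<pi>"
      using False by (simp add: psi_q_def t_def)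
    have Sym: "psi_q \<pi> \<in> Sym (Suc m)"
      using Sym_rho[OF \<pi>(1)] t_desc by (simp only: psi less_imp_le)
    have "KW_P (fshift (psi_q \<pi>)) = ((Suc m - t) # drop_trailing_zeros (map (\<lambda>x. Suc m - t - x) (map Suc c1))) #
      map (\<lambda>l. hd l # l) (blocks (0 # c1) c2)"
    proof (rule new[OF Sym])
      show "inv_code (psi_q \<pi>) = map Suc c1 @ 0 # c2"
        using inv_code_rho[OF \<pi>(1), of t] t_desc by (simp only: psi c1_def c2_def less_imp_le)
      show "sorted (map Suc c1)"
        using \<open>sorted c1\<close> by (simp add: sorted_wrt_map)
    qed (use c1 in auto)
    \<comment> \<open>Size and code entries grow together, so in the first partition only the first
      part increases.\<close>
    also have "map (\<lambda>x. Suc m - t - x) (map Suc c1) = map (\<lambda>x. m - t - x) c1"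
      by auto
    finally have "KW_P (fshift (psi_q \<pi>)) = ((Suc m - t) # drop_trailing_zeros (map (\<lambda>x. m - t - x) c1)) #
      map (\<lambda>l. hd l # l) (blocks (0 # c1) c2)" .
    \<comment> \<open>This selects the second branch of \<open>Psi2\<close>: equal parts would force
      \<open>c1\<close> into the form that characterizes sandwiched permutations.\<close>
    moreover have "\<not> (\<forall>x \<in> set (drop_trailing_zeros (map (\<lambda>x. m - t - x) c1)). x = m - t)"
    proof
      let ?L = "map (\<lambda>x. m - t - x) c1"
      assume all: "\<forall>x \<in> set (drop_trailing_zeros ?L). x = m - t"
      obtain b where "?L = drop_trailing_zeros ?L @ replicate b 0"
        by (rule drop_trailing_zeros_append_zeros)
      moreover define a where "a = length (drop_trailing_zeros ?L)"
      moreover have "drop_trailing_zeros ?L = replicate a (m - t)"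
        using all by (intro replicate_eqI) (auto simp: a_def)
      ultimately have L: "?L = replicate a (m - t) @ replicate b 0"
        by metis
      \<comment> \<open>Needed to undo the truncated subtraction and recover \<open>c1\<close> from
        its complement \<open>?L\<close>.\<close>
      have le: "x \<le> m - t" if "x \<in> set c1" for x
      proof -
        have "x \<le> last c1"
          using that \<open>sorted c1\<close> c1(2)
          by (metis append_butlast_last_id in_set_conv_decomp last_in_set sorted_append
            set_ConsD empty_iff empty_set append_Nil2 order_refl Un_iff set_append)
        also have "\<dots> = inv_code \<pi> ! (t - 1)"
          using c1(1,2) t_desc by (simp add: last_conv_nth c1_def)
        also have "\<dots> \<le> m - t"
          using inv_code_le[OF \<pi>(1), of "t - 1"] t_desc by simp
        finally show ?thesis .
      qed
      then have "map (\<lambda>x. m - t - (m - t - x)) c1 = c1"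
        by (intro map_idI) (simp only: diff_diff_cancel)
      then have "c1 = map (\<lambda>x. m - t - x) ?L"
        by (simp add: o_def del: diff_diff_left)
      also have "\<dots> = replicate a 0 @ replicate b (m - t)"
        unfolding L by simp
      finally have c: "c1 = replicate a 0 @ replicate b (m - t)" .
      then have "a + b = t"
        using c1(1) by (metis length_append length_replicate)
      \<comment> \<open>The last entry of \<open>c1\<close> exceeds the next code entry, so it is
        not \<open>0\<close>.\<close>
      moreover have "1 \<le> b"
      proof (rule ccontr)
        assume "\<not> 1 \<le> b"
        then have "last c1 = 0"
          using c c1(2) by (auto simp: last_replicate)
        then show False
          using c1(4) by simp
      qed
      ultimately have "sandwiched a b \<pi>"
        using t_desc code c by (intro sandwiched_if_inv_code[OF \<pi>(1)]) auto
      then show False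
        using False by blast
    qed
    ultimately have "KW_P (fshift (psi_q \<pi>)) = Psi2 (KW_P (fshift \<pi>))"
      unfolding old using t_desc by (simp add: Psi2_def Suc_diff_le del: diff_diff_left)
    then show ?thesis
      using Sym not_evil_rho[OF \<pi>(1,2) t_in t_le] by (simp add: psi)
  qed
  moreover have "length (Psi2 L) = length L" for L
    by (cases L) (simp_all add: Psi2_def)
  ultimately show "psi_q \<pi> \<in> Evil (Suc m) k" "KW_P (fshift (psi_q \<pi>)) = Psi2 (KW_P (fshift \<pi>))"
    using \<pi>(3) by (simp_all add: Evil_iff)
qed

theorem theorem5p16:
  shows "(\<forall>m k \<pi>. 1 \<le> m \<longrightarrow> 1 \<le> k \<longrightarrow> \<pi> \<in> Evil m k \<longrightarrow>
            psi_p \<pi> = inv_into (Evil (m + 1) k) fshift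
                         (inv_into (St (m + 2) k) KW_P (Psi1 (KW_P (fshift \<pi>))))) \<and>
         (\<forall>m k \<pi>. 1 \<le> m \<longrightarrow> 1 \<le> k \<longrightarrow> \<pi> \<in> Evil m k \<longrightarrow>
            psi_q \<pi> = inv_into (Evil (m + 1) k) fshift
                         (inv_into (St (m + 2) k) KW_P (Psi2 (KW_P (fshift \<pi>))))) \<and>
         (\<forall>k n i \<pi>. 1 \<le> k \<longrightarrow> k + 1 \<le> i \<longrightarrow> i + 1 \<le> n \<longrightarrow> \<pi> \<in> Evil (i - 1) (k - 1) \<longrightarrow>
            psi_ikn i k n \<pi> = inv_into (Evil (n - 1) k) fshift
                         (inv_into (St n k) KW_P (Phi i k n (KW_P (fshift \<pi>)))))"
proof (intro conjI allI impI)
  fix m k \<pi> assume "1 \<le> k" "\<pi> \<in> Evil m k"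
  then show "psi_p \<pi> = inv_into (Evil (m + 1) k) fshift
      (inv_into (St (m + 2) k) KW_P (Psi1 (KW_P (fshift \<pi>))))"
    "psi_q \<pi> = inv_into (Evil (m + 1) k) fshift
      (inv_into (St (m + 2) k) KW_P (Psi2 (KW_P (fshift \<pi>))))"
    using inv_into_fshift_KW_P[OF psi_p_correct] inv_into_fshift_KW_P[OF psi_q_correct] by simp_all
next
  fix k n i \<pi> assume *: "1 \<le> k" "k + 1 \<le> i" "i + 1 \<le> n" "\<pi> \<in> Evil (i - 1) (k - 1)"
  then have "Suc (n - 1) = n" "2 \<le> i"
    by auto
  then show "psi_ikn i k n \<pi> = inv_into (Evil (n - 1) k) fshift
      (inv_into (St n k) KW_P (Phi i k n (KW_P (fshift \<pi>))))"
    using inv_into_fshift_KW_P[OF psi_ikn_correct[OF *(4,1) _ *(3)]] by simp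
qed

end
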